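(* Every Prüfer extension $R\subseteq S$ is distributive.
   Context: All rings are commutative with unit. A ring extension $R\subseteq S$ means that $R$ is a subring of $S$ with the same unit. $[R,S]$ denotes the set of all $R$-subalgebras of $S$, ordered by inclusion; it is a lattice in which the infimum of $T,U$ is $T\cap U$ and the supremum is the compositum $TU$. The extension $R\subseteq S$ is called distributive if the lattice $[R,S]$ is distributive. An extension $R\subseteq S$ is called Prüfer if for every $T\in[R,S]$ the inclusion $R\subseteq T$ is a flat epimorphism (i.e. $T$ is a flat $R$-module and $R\to T$ is an epimorphism in the category of commutative rings). No finiteness condition on $[R,S]$ is assumed. *)

theory Defs
  imports "HOL-Algebra.Algebra"
begin

section \<open>Tensor products and flat modules\<close>

definition module_hom ::
    "('r, 'k) ring_scheme \<Rightarrow> ('r, 'c, 'd) module_scheme \<Rightarrow> ('r, 'e, 'f) module_scheme \<Rightarrow> ('c \<Rightarrow> 'e) set"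
  where "module_hom R M N = {f \<in> carrier M \<rightarrow> carrier N.
      (\<forall>x\<in>carrier M. \<forall>y\<in>carrier M. f (x \<oplus>\<^bsub>M\<^esub> y) = f x \<oplus>\<^bsub>N\<^esub> f y) \<and>
      (\<forall>r\<in>carrier R. \<forall>x\<in>carrier M. f (r \<odot>\<^bsub>M\<^esub> x) = r \<odot>\<^bsub>N\<^esub> f x)}"

definition tensor_relations ::
    "('r, 'k) ring_scheme \<Rightarrow> ('r, 'm, 'd) module_scheme \<Rightarrow> ('r, 'n, 'e) module_scheme
      \<Rightarrow> (('m \<times> 'n) \<Rightarrow>\<^sub>0 int) set"
  where "tensor_relations R M N = generate (free_Abelian_group (carrier M \<times> carrier N))
     ({frag_of (x \<oplus>\<^bsub>M\<^esub> x', y) - frag_of (x, y) - frag_of (x', y) | x x' y.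
         x \<in> carrier M \<and> x' \<in> carrier M \<and> y \<in> carrier N}
    \<union> {frag_of (x, y \<oplus>\<^bsub>N\<^esub> y') - frag_of (x, y) - frag_of (x, y') | x y y'.
         x \<in> carrier M \<and> y \<in> carrier N \<and> y' \<in> carrier N}
    \<union> {frag_of (r \<odot>\<^bsub>M\<^esub> x, y) - frag_of (x, r \<odot>\<^bsub>N\<^esub> y) | r x y.
         r \<in> carrier R \<and> x \<in> carrier M \<and> y \<in> carrier N})"

text \<open>
  Only the underlying abelian group of the tensor product is recorded; this is all that is
  needed to say that a map between tensor products is injective.
\<close>

definition tensor_product ::
    "('r, 'k) ring_scheme \<Rightarrow> ('r, 'm, 'd) module_scheme \<Rightarrow> ('r, 'n, 'e) module_scheme
      \<Rightarrow> (('m \<times> 'n) \<Rightarrow>\<^sub>0 int) set monoid"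
  where "tensor_product R M N =
    free_Abelian_group (carrier M \<times> carrier N) Mod tensor_relations R M N"

text \<open>
  The map \<open>id \<otimes> f\<close> from \<open>M \<otimes> N\<close> to \<open>M \<otimes> N'\<close>.  Elements of the tensor product are cosets;
  the coset of \<open>c\<close> is sent to the coset of the image of \<open>c\<close> under the map of free groups induced
  by \<open>(x, y) \<mapsto> (x, f y)\<close>.
\<close>

definition tensor_map ::
    "('r, 'k) ring_scheme \<Rightarrow> ('r, 'm, 'd) module_scheme \<Rightarrow> ('r, 'n', 'e) module_scheme \<Rightarrow> ('n \<Rightarrow> 'n')
      \<Rightarrow> (('m \<times> 'n) \<Rightarrow>\<^sub>0 int) set \<Rightarrow> (('m \<times> 'n') \<Rightarrow>\<^sub>0 int) set"
  where "tensor_map R M N' f Z =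
    tensor_relations R M N' <#>\<^bsub>free_Abelian_group (carrier M \<times> carrier N')\<^esub>
      (frag_extend (\<lambda>(x, y). frag_of (x, f y)) ` Z)"

text \<open>
  HOL cannot quantify over types inside a definition, so the test modules (here) and test rings
  (below) have their carriers in a type given as a parameter.  Once that type is infinite and at
  least as large as the types of the rings involved, the choice does not matter: flatness is already
  detected by the inclusions of ideals of \<open>R\<close> into \<open>R\<close>, and a pair of ring homomorphisms out of \<open>B\<close>
  has its image in the subring generated by two images of \<open>B\<close>.
\<close>

definition flat_module ::
    "'c itself \<Rightarrow> ('r, 'k) ring_scheme \<Rightarrow> ('r, 'm, 'd) module_scheme \<Rightarrow> bool"
  where "flat_module T R M \<longleftrightarrow> module R M \<and>
    (\<forall>(N :: ('r, 'c) module) (N' :: ('r, 'c) module) f.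
       module R N \<and> module R N' \<and> f \<in> module_hom R N N' \<and> inj_on f (carrier N) \<longrightarrow>
       inj_on (tensor_map R M N' f) (carrier (tensor_product R M N)))"


section \<open>Epimorphisms of commutative rings\<close>

definition cring_epimorphism ::
    "'c itself \<Rightarrow> ('a, 'k) ring_scheme \<Rightarrow> ('b, 'l) ring_scheme \<Rightarrow> ('a \<Rightarrow> 'b) \<Rightarrow> bool"
  where "cring_epimorphism T A B f \<longleftrightarrow> cring A \<and> cring B \<and> f \<in> ring_hom A B \<and>
    (\<forall>(C :: 'c ring) g h.
       cring C \<and> g \<in> ring_hom B C \<and> h \<in> ring_hom B C \<and>
       (\<forall>a\<in>carrier A. g (f a) = h (f a)) \<longrightarrow> (\<forall>b\<in>carrier B. g b = h b))"


section \<open>Ring extensions\<close>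

definition ring_extension :: "'a set \<Rightarrow> ('a, 'k) ring_scheme \<Rightarrow> bool"
  where "ring_extension R S \<longleftrightarrow> cring S \<and> subring R S"

text \<open>The interval \<open>[R, S]\<close>.  An \<open>R\<close>-subalgebra of \<open>S\<close> is a subring of \<open>S\<close> containing \<open>R\<close>.\<close>

definition intermediate_rings :: "'a set \<Rightarrow> ('a, 'k) ring_scheme \<Rightarrow> 'a set set"
  where "intermediate_rings R S = {T. subring T S \<and> R \<subseteq> T}"

definition intermediate_order :: "'a set \<Rightarrow> ('a, 'k) ring_scheme \<Rightarrow> 'a set gorder"
  where "intermediate_order R S = \<lparr>carrier = intermediate_rings R S, eq = (=), le = (\<subseteq>)\<rparr>"

definition distributive_lattice :: "('a, 'k) gorder_scheme \<Rightarrow> bool"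
  where "distributive_lattice L \<longleftrightarrow> lattice L \<and>
    (\<forall>x\<in>carrier L. \<forall>y\<in>carrier L. \<forall>z\<in>carrier L.
       x \<sqinter>\<^bsub>L\<^esub> (y \<squnion>\<^bsub>L\<^esub> z) = (x \<sqinter>\<^bsub>L\<^esub> y) \<squnion>\<^bsub>L\<^esub> (x \<sqinter>\<^bsub>L\<^esub> z))"

definition distributive_extension :: "'a set \<Rightarrow> ('a, 'k) ring_scheme \<Rightarrow> bool"
  where "distributive_extension R S \<longleftrightarrow>
    ring_extension R S \<and> distributive_lattice (intermediate_order R S)"

definition as_ring :: "('a, 'k) ring_scheme \<Rightarrow> 'a set \<Rightarrow> ('a, 'k) ring_scheme"
  where "as_ring S T = S\<lparr>carrier := T\<rparr>"

text \<open>A subset \<open>T\<close> of \<open>S\<close> as a module over a subring of \<open>S\<close>, by multiplication in \<open>S\<close>.\<close>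

definition as_module :: "('a, 'k) ring_scheme \<Rightarrow> 'a set \<Rightarrow> ('a, 'a) module"
  where "as_module S T = \<lparr>carrier = T, monoid.mult = monoid.mult S, one = \<one>\<^bsub>S\<^esub>,
    ring.zero = \<zero>\<^bsub>S\<^esub>, add = add S, smult = monoid.mult S\<rparr>"

text \<open>
  A type for the test objects.  It is infinite, it is at least as large as \<open>'a\<close>, and it is the type of
  elements of a tensor product of two modules with carriers in \<open>'a\<close>.
\<close>

type_synonym 'a test = "(('a \<times> 'a) \<Rightarrow>\<^sub>0 int) set"

definition flat_epimorphic :: "('a, 'k) ring_scheme \<Rightarrow> 'a set \<Rightarrow> 'a set \<Rightarrow> bool"
  where "flat_epimorphic S R T \<longleftrightarrow>
    flat_module TYPE('a test) (as_ring S R) (as_module S T) \<and>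
    cring_epimorphism TYPE('a test) (as_ring S R) (as_ring S T) (\<lambda>x. x)"

definition pruefer_extension :: "'a set \<Rightarrow> ('a, 'k) ring_scheme \<Rightarrow> bool"
  where "pruefer_extension R S \<longleftrightarrow> ring_extension R S \<and>
    (\<forall>T\<in>intermediate_rings R S. flat_epimorphic S R T)"

end

theory Submission
  imports Defs
begin

text \<open>
  Write \<open>(R : x)\<close> for the ideal of all \<open>r \<in> R\<close> with \<open>r x \<in> R\<close>.  A flat epimorphism \<open>R \<subseteq> T\<close>
  satisfies \<open>(R : x) T = T\<close> for all \<open>x \<in> T\<close> (\<open>flat_epimorphism_conductor\<close>): the epimorphism gives
  \<open>1 \<otimes> x = x \<otimes> 1\<close> in \<open>T \<otimes> T\<close>, flatness moves this equation into \<open>T \<otimes> (R + R x)\<close>, and comparing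
  coefficients of \<open>x\<close> modulo \<open>(R : x) T\<close> gives \<open>1 = 0\<close>.

  In a Pruefer extension this holds for all intermediate rings \<open>T\<close>, and it forces valuation-like
  behaviour at each prime \<open>p\<close> of \<open>R\<close>: an element of \<open>S\<close> either belongs to \<open>R\<close> locally at \<open>p\<close>, or it is
  invertible there with inverse in \<open>R\<close> (\<open>fraction_or_inverse\<close>).  The proof is the degree-lowering
  argument known from the existence of valuation rings.  Consequently the intermediate rings form
  a chain locally at \<open>p\<close> (\<open>localised_chain\<close>).

  In a chain the supremum of two members is one of them, so the distributive law is trivial.
  Since an element belongs to an intermediate ring if it does so locally at every prime of \<open>R\<close>,
  the law holds globally as well (\<open>inter_compositum_subset\<close>).
\<close>

section \<open>The monoid ring of a commutative monoid\<close>

lemma keys_frag_diff: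
  "Poly_Mapping.keys a \<subseteq> C \<Longrightarrow> Poly_Mapping.keys b \<subseteq> C \<Longrightarrow> Poly_Mapping.keys (a - b) \<subseteq> C"
  using keys_diff[of a b] by blast

lemma frag_extend_fun_add:
  "frag_extend (\<lambda>p. f p + g p) z = frag_extend f z + frag_extend g z"
  by (simp add: frag_extend_def frag_cmul_distrib2 sum.distrib)

lemma frag_extend_fun_diff:
  "frag_extend (\<lambda>p. f p - g p) z = frag_extend f z - frag_extend g z"
  using frag_extend_fun_add[of "\<lambda>p. f p - g p" g z] by simp

text \<open>
  Integral group-ring elements are represented by finitely supported functions, as in the free
  abelian group on the carrier; multiplication extends that of the monoid bilinearly.  The index
  monoid is a record, because it has to be the tensor square of an arbitrary subring.
\<close>

definition frag_mult :: "('a, 'k) monoid_scheme \<Rightarrow> ('a \<Rightarrow>\<^sub>0 int) \<Rightarrow> ('a \<Rightarrow>\<^sub>0 int) \<Rightarrow> ('a \<Rightarrow>\<^sub>0 int)"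
  where "frag_mult G a b = frag_extend (\<lambda>p. frag_extend (\<lambda>q. frag_of (p \<otimes>\<^bsub>G\<^esub> q)) b) a"

definition monoid_ring :: "('a, 'k) monoid_scheme \<Rightarrow> ('a \<Rightarrow>\<^sub>0 int) ring"
  where "monoid_ring G = \<lparr>carrier = {z. Poly_Mapping.keys z \<subseteq> carrier G}, monoid.mult = frag_mult G,
    one = frag_of \<one>\<^bsub>G\<^esub>, ring.zero = 0, add = (+)\<rparr>"

lemma frag_mult_simps [simp]:
  "frag_mult G 0 c = 0" "frag_mult G c 0 = 0"
  "frag_mult G (a + b) c = frag_mult G a c + frag_mult G b c"
  "frag_mult G c (a + b) = frag_mult G c a + frag_mult G c b"
  "frag_mult G (a - b) c = frag_mult G a c - frag_mult G b c"
  "frag_mult G c (a - b) = frag_mult G c a - frag_mult G c b"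
  "frag_mult G (frag_of p) (frag_of q) = frag_of (p \<otimes>\<^bsub>G\<^esub> q)"
  by (simp_all add: frag_mult_def frag_extend_add frag_extend_diff frag_extend_fun_add
      frag_extend_fun_diff frag_extend_eq_0)

lemma add_monoid_monoid_ring: "add_monoid (monoid_ring G) = free_Abelian_group (carrier G)"
  by (simp add: monoid_ring_def free_Abelian_group_def)

lemma (in comm_monoid) cring_monoid_ring: "cring (monoid_ring G)"
proof (rule cringI)
  show "abelian_group (monoid_ring G)"
    using comm_group.axioms[OF abelian_free_Abelian_group[of "carrier G"]]
    by (intro abelian_group.intro abelian_monoid.intro abelian_group_axioms.intro)
       (simp_all only: add_monoid_monoid_ring abelian_free_Abelian_group)
  have closed: "Poly_Mapping.keys (frag_mult G a b) \<subseteq> carrier G"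
    if a: "Poly_Mapping.keys a \<subseteq> carrier G" and b: "Poly_Mapping.keys b \<subseteq> carrier G" for a b
    using a
  proof (induction rule: frag_induction)
    case (one p)
    show ?case using b
    proof (induction rule: frag_induction)
      case (diff x y)
      then show ?case by (simp add: keys_frag_diff)
    qed (use one in auto)
  next
    case (diff x y)
    then show ?case by (simp add: keys_frag_diff)
  qed simp
  have comm: "frag_mult G a b = frag_mult G b a"
    if a: "Poly_Mapping.keys a \<subseteq> carrier G" and b: "Poly_Mapping.keys b \<subseteq> carrier G" for a b
    using a
  proof (induction rule: frag_induction)
    case (one p)
    show ?case using b
      by (induction rule: frag_induction) (use one in \<open>auto simp: m_comm\<close>)
  qed auto
  have assoc: "frag_mult G (frag_mult G a b) c = frag_mult G a (frag_mult G b c)"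
    if a: "Poly_Mapping.keys a \<subseteq> carrier G" and b: "Poly_Mapping.keys b \<subseteq> carrier G"
      and c: "Poly_Mapping.keys c \<subseteq> carrier G" for a b c
    using a
  proof (induction rule: frag_induction)
    case (one p)
    show ?case using b
    proof (induction rule: frag_induction)
      case (one q)
      show ?case using c
        by (induction rule: frag_induction) (use one \<open>p \<in> carrier G\<close> in \<open>auto simp: m_assoc\<close>)
    qed auto
  qed auto
  have one: "frag_mult G (frag_of \<one>) a = a" if a: "Poly_Mapping.keys a \<subseteq> carrier G" for a
    using a by (induction rule: frag_induction) auto
  show "comm_monoid (monoid_ring G)"
    by (rule comm_monoidI) (use closed comm assoc one in \<open>auto simp: monoid_ring_def\<close>)
qed (simp add: monoid_ring_def)

section \<open>Relations in a tensor product\<close>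

context
  fixes R :: "('r, 'k) ring_scheme" and M :: "('r, 'm, 'd) module_scheme"
    and N :: "('r, 'n, 'e) module_scheme"
begin

lemma tensor_relations_add_left:
  "x \<in> carrier M \<Longrightarrow> x' \<in> carrier M \<Longrightarrow> y \<in> carrier N \<Longrightarrow>
    frag_of (x \<oplus>\<^bsub>M\<^esub> x', y) - frag_of (x, y) - frag_of (x', y) \<in> tensor_relations R M N"
  unfolding tensor_relations_def by (rule generate.incl) blast

lemma tensor_relations_add_right:
  "x \<in> carrier M \<Longrightarrow> y \<in> carrier N \<Longrightarrow> y' \<in> carrier N \<Longrightarrow>
    frag_of (x, y \<oplus>\<^bsub>N\<^esub> y') - frag_of (x, y) - frag_of (x, y') \<in> tensor_relations R M N"
  unfolding tensor_relations_def by (rule generate.incl) blast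

lemma tensor_relations_smult:
  "r \<in> carrier R \<Longrightarrow> x \<in> carrier M \<Longrightarrow> y \<in> carrier N \<Longrightarrow>
    frag_of (r \<odot>\<^bsub>M\<^esub> x, y) - frag_of (x, r \<odot>\<^bsub>N\<^esub> y) \<in> tensor_relations R M N"
  unfolding tensor_relations_def by (rule generate.incl) blast

context
  assumes M: "module R M" and N: "module R N"
begin

lemma subgroup_tensor_relations:
  "subgroup (tensor_relations R M N) (free_Abelian_group (carrier M \<times> carrier N))"
proof -
  interpret M: module R M by (rule M)
  interpret N: module R N by (rule N)
  show ?thesis
    unfolding tensor_relations_def
    by (rule group.generate_is_subgroup[OF group_free_Abelian_group])
       (auto intro!: keys_frag_diff dest!: subsetD[OF keys_diff])
qed

lemma tensor_relations_carrier:
  "z \<in> tensor_relations R M N \<Longrightarrow> Poly_Mapping.keys z \<subseteq> carrier M \<times> carrier N"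
  using subsetD[OF subgroup.subset[OF subgroup_tensor_relations]]
  by (metis carrier_free_Abelian_group_iff)

lemma tensor_relations_zero: "0 \<in> tensor_relations R M N"
  using subgroup.one_closed[OF subgroup_tensor_relations] by simp

lemma tensor_relations_add:
  "a \<in> tensor_relations R M N \<Longrightarrow> b \<in> tensor_relations R M N \<Longrightarrow> a + b \<in> tensor_relations R M N"
  using subgroup.m_closed[OF subgroup_tensor_relations] by simp

lemma tensor_relations_diff:
  assumes "a \<in> tensor_relations R M N" "b \<in> tensor_relations R M N"
  shows "a - b \<in> tensor_relations R M N"
  using tensor_relations_add[OF assms(1), of "- b"] tensor_relations_carrier[OF assms(2)]
    subgroup.m_inv_closed[OF subgroup_tensor_relations assms(2)]
  by simp

end

end

text \<open>
  The negatives of the generators and the sums both reduce to differences, so a property that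
  is to be checked on all relations only has to survive differences.
\<close>

lemma tensor_relations_induct [consumes 3, case_names zero add_left add_right smult diff]:
  assumes M: "module R M" and N: "module R N" and z: "z \<in> tensor_relations R M N"
    and zero: "P 0"
    and add_left: "\<And>x x' y. x \<in> carrier M \<Longrightarrow> x' \<in> carrier M \<Longrightarrow> y \<in> carrier N \<Longrightarrow>
      P (frag_of (x \<oplus>\<^bsub>M\<^esub> x', y) - frag_of (x, y) - frag_of (x', y))"
    and add_right: "\<And>x y y'. x \<in> carrier M \<Longrightarrow> y \<in> carrier N \<Longrightarrow> y' \<in> carrier N \<Longrightarrow>
      P (frag_of (x, y \<oplus>\<^bsub>N\<^esub> y') - frag_of (x, y) - frag_of (x, y'))"
    and smult: "\<And>r x y. r \<in> carrier R \<Longrightarrow> x \<in> carrier M \<Longrightarrow> y \<in> carrier N \<Longrightarrow>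
      P (frag_of (r \<odot>\<^bsub>M\<^esub> x, y) - frag_of (x, r \<odot>\<^bsub>N\<^esub> y))"
    and diff: "\<And>a b. a \<in> tensor_relations R M N \<Longrightarrow> b \<in> tensor_relations R M N \<Longrightarrow>
      P a \<Longrightarrow> P b \<Longrightarrow> P (a - b)"
  shows "P z"
proof -
  have generator: "h \<in> tensor_relations R M N \<and> P h"
    if "h \<in> {frag_of (x \<oplus>\<^bsub>M\<^esub> x', y) - frag_of (x, y) - frag_of (x', y) | x x' y.
         x \<in> carrier M \<and> x' \<in> carrier M \<and> y \<in> carrier N}
      \<union> {frag_of (x, y \<oplus>\<^bsub>N\<^esub> y') - frag_of (x, y) - frag_of (x, y') | x y y'.
         x \<in> carrier M \<and> y \<in> carrier N \<and> y' \<in> carrier N}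
      \<union> {frag_of (r \<odot>\<^bsub>M\<^esub> x, y) - frag_of (x, r \<odot>\<^bsub>N\<^esub> y) | r x y.
         r \<in> carrier R \<and> x \<in> carrier M \<and> y \<in> carrier N}" for h
    using that
    by (elim UnE CollectE exE conjE)
      (simp_all only: add_left add_right smult tensor_relations_add_left tensor_relations_add_right
        tensor_relations_smult simp_thms)
  have "z \<in> tensor_relations R M N \<and> P z"
    using z[unfolded tensor_relations_def]
  proof (induction rule: generate.induct)
    case one
    then show ?case using zero tensor_relations_zero[OF M N] by simp
  next
    case (incl h)
    then show ?case by (rule generator)
  next
    case (inv h)
    have h: "h \<in> tensor_relations R M N" "P h"
      using generator[OF inv] by simp_all
    then have "inv\<^bsub>free_Abelian_group (carrier M \<times> carrier N)\<^esub> h = 0 - h"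
      using tensor_relations_carrier[OF M N] by simp
    then show ?case using tensor_relations_diff[OF M N tensor_relations_zero[OF M N] h(1)]
        diff[OF tensor_relations_zero[OF M N] h(1) zero h(2)] by simp
  next
    case (eng a b)
    have "- b \<in> tensor_relations R M N" "P (- b)"
      using tensor_relations_diff[OF M N tensor_relations_zero[OF M N], of b] diff[OF tensor_relations_zero[OF M N] _ zero, of b] eng
      by simp_all
    then show ?case using tensor_relations_add[OF M N, of a b] diff[of a "- b"] eng by simp
  qed
  then show ?thesis ..
qed

lemma tensor_relations_functorial:
  fixes N :: "('r, 'n, 'e) module_scheme" and N' :: "('r, 'n', 'e') module_scheme"
  assumes M: "module R M" and N: "module R N" and N': "module R N'"
    and f: "f \<in> module_hom R N N'" and z: "z \<in> tensor_relations R M N"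
  shows "frag_extend (\<lambda>(x, y). frag_of (x, f y)) z \<in> tensor_relations R M N'"
  using M N z
proof (induction rule: tensor_relations_induct)
  case (diff a b)
  then show ?case by (simp add: frag_extend_diff tensor_relations_diff[OF M N'])
next
  case (add_left x x' y)
  then show ?case using f
    by (auto simp: frag_extend_diff module_hom_def intro!: tensor_relations_add_left)
next
  case (add_right x y y')
  then show ?case using f
    by (auto simp: frag_extend_diff module_hom_def intro!: tensor_relations_add_right)
next
  case (smult r x y)
  then show ?case using f
    by (auto simp: frag_extend_diff module_hom_def intro!: tensor_relations_smult)
qed (simp add: tensor_relations_zero[OF M N'])

text \<open>
  Elements of a tensor product are cosets of the group of relations, and \<open>tensor_map\<close> sends the
  coset of an element \<open>z\<close> to all of the relation group of \<open>M \<otimes> N'\<close> as soon as the image of \<open>z\<close> is a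
  relation.  The zero coset has the same image, so injectivity makes \<open>z\<close> itself a relation.
\<close>

lemma flat_module_reflects_relations:
  fixes N N' :: "('r, 'c) module"
  assumes flat: "flat_module TYPE('c) R M"
    and N: "module R N" and N': "module R N'"
    and f: "f \<in> module_hom R N N'" "inj_on f (carrier N)"
    and z: "Poly_Mapping.keys z \<subseteq> carrier M \<times> carrier N"
    and fz: "frag_extend (\<lambda>(x, y). frag_of (x, f y)) z \<in> tensor_relations R M N'"
  shows "z \<in> tensor_relations R M N"
proof -
  have M: "module R M" using flat by (simp add: flat_module_def)
  let ?G = "free_Abelian_group (carrier M \<times> carrier N)"
  let ?K = "tensor_relations R M N" and ?K' = "tensor_relations R M N'"
  have coset_to_zero: "tensor_map R M N' f (?K #>\<^bsub>?G\<^esub> w) = ?K'"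
    if w: "frag_extend (\<lambda>(x, y). frag_of (x, f y)) w \<in> ?K'" for w
  proof -
    define Y where "Y = frag_extend (\<lambda>(x, y). frag_of (x, f y)) ` (?K #>\<^bsub>?G\<^esub> w)"
    have Y: "Y \<subseteq> ?K'"
      using tensor_relations_functorial[OF M N N' f(1)] w tensor_relations_add[OF M N']
      by (auto simp: Y_def r_coset_def frag_extend_add)
    obtain u where u: "u \<in> Y"
      using tensor_relations_zero[OF M N] by (auto simp: Y_def r_coset_def)
    have "tensor_map R M N' f (?K #>\<^bsub>?G\<^esub> w) = {a + b | a b. a \<in> ?K' \<and> b \<in> Y}"
      by (auto simp: tensor_map_def Y_def[symmetric] set_mult_def)
    also have "\<dots> = ?K'"
    proof
      show "{a + b | a b. a \<in> ?K' \<and> b \<in> Y} \<subseteq> ?K'"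
        using Y tensor_relations_add[OF M N'] by blast
      have "a = (a - u) + u \<and> a - u \<in> ?K'" if "a \<in> ?K'" for a
        using that u Y tensor_relations_diff[OF M N'] by auto
      then show "?K' \<subseteq> {a + b | a b. a \<in> ?K' \<and> b \<in> Y}" using u by blast
    qed
    finally show ?thesis .
  qed
  have in_tp: "?K #>\<^bsub>?G\<^esub> w \<in> carrier (tensor_product R M N)"
    if "Poly_Mapping.keys w \<subseteq> carrier M \<times> carrier N" for w
    using that by (auto simp: tensor_product_def FactGroup_def RCOSETS_def)
  have inj: "inj_on (tensor_map R M N' f) (carrier (tensor_product R M N))"
    using flat N N' f by (simp add: flat_module_def)
  have "?K #>\<^bsub>?G\<^esub> z = ?K #>\<^bsub>?G\<^esub> 0"
    by (rule inj_onD[OF inj])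
       (use coset_to_zero[OF fz] coset_to_zero[of 0] in_tp[OF z] in_tp[of 0]
          tensor_relations_zero[OF M N'] in simp_all)
  moreover have "z \<in> ?K #>\<^bsub>?G\<^esub> z" using tensor_relations_zero[OF M N] by (auto simp: r_coset_def)
  ultimately show ?thesis by (auto simp: r_coset_def)
qed

text \<open>
  Flatness is tested on modules whose elements have one fixed type.  Transport along an injection
  into that type makes a submodule of the ring under study available as a test module.
\<close>

definition module_copy :: "('m \<Rightarrow> 'n) \<Rightarrow> ('r, 'm, 'd) module_scheme \<Rightarrow> ('r, 'n) module"
  where "module_copy e M = \<lparr>carrier = e ` carrier M,
    monoid.mult = (\<lambda>u v. e (inv_into UNIV e u \<otimes>\<^bsub>M\<^esub> inv_into UNIV e v)), one = e \<one>\<^bsub>M\<^esub>,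
    ring.zero = e \<zero>\<^bsub>M\<^esub>, add = (\<lambda>u v. e (inv_into UNIV e u \<oplus>\<^bsub>M\<^esub> inv_into UNIV e v)),
    smult = (\<lambda>r u. e (r \<odot>\<^bsub>M\<^esub> inv_into UNIV e u))\<rparr>"

lemma module_module_copy:
  assumes M: "module R M" and e: "inj e"
  shows "module R (module_copy e M)"
proof -
  interpret M: module R M by (rule M)
  show ?thesis
  proof (rule moduleI)
    show "cring R" using M by (simp add: module_def)
    have "\<exists>b\<in>carrier M. e (b \<oplus>\<^bsub>M\<^esub> a) = e \<zero>\<^bsub>M\<^esub>" if "a \<in> carrier M" for a
      using that M.M.l_neg M.M.a_inv_closed by metis
    then show "abelian_group (module_copy e M)"
      by (intro abelian_groupI)
        (auto simp: module_copy_def e M.M.a_ac)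
  qed (auto simp: module_copy_def e M.smult_l_distr M.smult_r_distr M.smult_assoc1)
qed

lemma module_copy_hom: "inj e \<Longrightarrow> e \<in> module_hom R M (module_copy e M)"
  by (auto simp: module_hom_def module_copy_def)

section \<open>Conductors of flat epimorphisms\<close>

context cring
begin

lemma module_as_module:
  assumes A: "subring A R" and N: "subgroup N (add_monoid R)"
    and AN: "\<And>a n. a \<in> A \<Longrightarrow> n \<in> N \<Longrightarrow> a \<otimes> n \<in> N"
  shows "module (as_ring R A) (as_module R N)"
proof (rule moduleI)
  have [simp]: "n \<in> carrier R" if "n \<in> N" for n using subgroup.subset[OF N] that by auto
  have [simp]: "a \<in> carrier R" if "a \<in> A" for a using subringE(1)[OF A] that by auto
  show "cring (as_ring R A)"
    unfolding as_ring_def using subcring_iff[OF subringE(1)[OF A]] subcringI'[OF A] by blast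
  have "\<exists>m\<in>N. m \<oplus> n = \<zero>" if "n \<in> N" for n
    using subgroup.m_inv_closed[OF N that] that l_neg[of n] unfolding a_inv_def[symmetric]
    by (intro bexI[of _ "\<ominus> n"]) auto
  then show "abelian_group (as_module R N)"
    using subgroup.m_closed[OF N] subgroup.one_closed[OF N]
    by (intro abelian_groupI) (auto simp: as_module_def a_ac)
qed (use AN subringE(1)[OF A] subgroup.subset[OF N] in \<open>auto simp: as_module_def as_ring_def l_distr r_distr m_assoc subset_iff\<close>)

text \<open>
  The monoid ring of \<open>T \<times> T\<close> (under multiplication) is the free abelian group from which \<open>T \<otimes> T\<close> is
  formed, now with its ring structure.
\<close>

lemma comm_monoid_tensor_square:
  assumes T: "subring T R"
  shows "comm_monoid (as_ring R T \<times>\<times> as_ring R T)"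
  using subringE(1,3,6)[OF T]
  by (intro comm_monoidI) (auto simp: as_ring_def m_ac subset_iff)

text \<open>
  Multiplying a defining relation of \<open>T \<otimes> T\<close> by a pure tensor gives a defining relation of the
  same kind.  Hence the relations form an ideal, and the quotient is the ring \<open>T \<otimes> T\<close>.
\<close>

lemma ideal_tensor_relations:
  assumes A: "subring A R" and T: "subring T R" "A \<subseteq> T"
  shows "ideal (tensor_relations (as_ring R A) (as_module R T) (as_module R T))
    (monoid_ring (as_ring R T \<times>\<times> as_ring R T))"
proof -
  let ?M = "as_module R T" and ?G = "as_ring R T \<times>\<times> as_ring R T"
  let ?K = "tensor_relations (as_ring R A) ?M ?M"
  note Ts = subringE[OF T(1)]
  have M: "module (as_ring R A) ?M"
    using T Ts(6) by (intro module_as_module A) (auto simp: subring_def)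
  interpret C: cring "monoid_ring ?G"
    by (rule comm_monoid.cring_monoid_ring[OF comm_monoid_tensor_square[OF T(1)]])
  have single: "frag_mult ?G z (frag_of (a, b)) \<in> ?K" if z: "z \<in> ?K" and ab: "a \<in> T" "b \<in> T" for z a b
    using M M z
  proof (induction rule: tensor_relations_induct)
    case (add_left x x' y)
    then have "x \<in> carrier R" "x' \<in> carrier R" "a \<in> carrier R" using Ts(1) ab by (auto simp: as_module_def)
    then show ?case
      using tensor_relations_add_left[of "x \<otimes> a" ?M "x' \<otimes> a" "y \<otimes> b" ?M "as_ring R A"] add_left ab Ts(6)
      by (auto simp: as_module_def as_ring_def l_distr)
  next
    case (add_right x y y')
    then have "y \<in> carrier R" "y' \<in> carrier R" "b \<in> carrier R" using Ts(1) ab by (auto simp: as_module_def)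
    then show ?case
      using tensor_relations_add_right[of "x \<otimes> a" ?M "y \<otimes> b" ?M "y' \<otimes> b" "as_ring R A"] add_right ab Ts(6)
      by (auto simp: as_module_def as_ring_def l_distr)
  next
    case (smult r x y)
    then have "r \<in> carrier R" "x \<in> carrier R" "y \<in> carrier R" "a \<in> carrier R" "b \<in> carrier R"
      using Ts(1) T(2) ab by (auto simp: as_module_def as_ring_def)
    then show ?case
      using tensor_relations_smult[of r "as_ring R A" "x \<otimes> a" ?M "y \<otimes> b" ?M] smult ab Ts(6)
      by (auto simp: as_module_def as_ring_def m_assoc)
  qed (simp_all add: tensor_relations_zero[OF M M] tensor_relations_diff[OF M M])
  have mult: "frag_mult ?G z w \<in> ?K" if z: "z \<in> ?K" and w: "w \<in> carrier (monoid_ring ?G)" for z w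
  proof -
    have "Poly_Mapping.keys w \<subseteq> T \<times> T" using w by (simp add: monoid_ring_def as_ring_def)
    then show ?thesis
      by (induction rule: frag_induction)
        (use z single in \<open>auto simp: tensor_relations_zero[OF M M] tensor_relations_diff[OF M M]\<close>)
  qed
  show ?thesis
  proof (rule idealI[OF C.ring_axioms])
    have "carrier ?G = carrier ?M \<times> carrier ?M" by (simp add: as_ring_def as_module_def)
    then show "subgroup ?K (add_monoid (monoid_ring ?G))"
      using subgroup_tensor_relations[OF M M] by (simp only: add_monoid_monoid_ring)
    fix z w assume z: "z \<in> ?K" and w: "w \<in> carrier (monoid_ring ?G)"
    then show *: "z \<otimes>\<^bsub>monoid_ring ?G\<^esub> w \<in> ?K" using mult by (simp add: monoid_ring_def)
    have "z \<in> carrier (monoid_ring ?G)"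
      using tensor_relations_carrier[OF M M z] by (simp add: monoid_ring_def as_ring_def as_module_def)
    then show "w \<otimes>\<^bsub>monoid_ring ?G\<^esub> z \<in> ?K" using * C.m_comm[OF _ w] by simp
  qed
qed

text \<open>
  The two ring homomorphisms \<open>t \<mapsto> t \<otimes> 1\<close> and \<open>t \<mapsto> 1 \<otimes> t\<close> from \<open>T\<close> to \<open>T \<otimes> T\<close> agree on \<open>A\<close>.
  If \<open>A \<subseteq> T\<close> is an epimorphism, they are equal.
\<close>

lemma epimorphism_tensor_symmetric:
  assumes A: "subring A R" and T: "subring T R" "A \<subseteq> T"
    and epi: "cring_epimorphism TYPE((('a \<times> 'a) \<Rightarrow>\<^sub>0 int) set) (as_ring R A) (as_ring R T) (\<lambda>x. x)"
    and x: "x \<in> T"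
  shows "frag_of (\<one>, x) - frag_of (x, \<one>) \<in> tensor_relations (as_ring R A) (as_module R T) (as_module R T)"
proof -
  let ?M = "as_module R T" and ?G = "as_ring R T \<times>\<times> as_ring R T"
  let ?K = "tensor_relations (as_ring R A) ?M ?M"
  let ?C = "monoid_ring ?G"
  note Ts = subringE[OF T(1)]
  interpret C: cring ?C
    by (rule comm_monoid.cring_monoid_ring[OF comm_monoid_tensor_square[OF T(1)]])
  interpret K: ideal ?K ?C by (rule ideal_tensor_relations[OF A T])
  let ?cos = "\<lambda>z. ?K +>\<^bsub>?C\<^esub> z"
  have cr: "cring (?C Quot ?K)" by (rule K.quotient_is_cring[OF C.cring_axioms])
  have hom: "?cos \<in> ring_hom ?C (?C Quot ?K)" by (rule K.rcos_ring_hom)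
  have minus: "z \<ominus>\<^bsub>?C\<^esub> w = z - w" if "z \<in> carrier ?C" "w \<in> carrier ?C" for z w
  proof -
    have "Poly_Mapping.keys w \<subseteq> T \<times> T" using that by (simp add: monoid_ring_def as_ring_def)
    then have "\<ominus>\<^bsub>?C\<^esub> w = - w"
      unfolding a_inv_def add_monoid_monoid_ring by (simp add: as_ring_def)
    then show ?thesis by (simp add: a_minus_def) (simp add: monoid_ring_def)
  qed
  have cos_eq: "?cos z = ?cos w \<longleftrightarrow> z - w \<in> ?K" if "z \<in> carrier ?C" "w \<in> carrier ?C" for z w
    using C.quotient_eq_iff_same_a_r_cos[OF K.is_ideal that] minus[OF that] by simp
  have C_simps: "frag_of (a, b) \<in> carrier ?C \<longleftrightarrow> a \<in> T \<and> b \<in> T"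
    "z \<oplus>\<^bsub>?C\<^esub> w = z + w" "\<one>\<^bsub>?C\<^esub> = frag_of (\<one>, \<one>)"
    "frag_of (a, b) \<otimes>\<^bsub>?C\<^esub> frag_of (c, d) = frag_of (a \<otimes> c, b \<otimes> d)" for a b c d z w
    by (auto simp: monoid_ring_def as_ring_def)
  have C_add: "z + w \<in> carrier ?C" if "z \<in> carrier ?C" "w \<in> carrier ?C" for z w
    using C.a_closed[OF that] by (simp add: C_simps)
  define g where "g t = ?cos (frag_of (t, \<one>))" for t
  define h where "h t = ?cos (frag_of (\<one>, t))" for t
  have T_carrier: "carrier (as_ring R T) = T" "carrier (as_ring R A) = A" "carrier ?M = T"
    by (simp_all add: as_ring_def as_module_def)
  have M_simps: "u \<oplus>\<^bsub>?M\<^esub> v = u \<oplus> v" "u \<odot>\<^bsub>?M\<^esub> v = u \<otimes> v" for u v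
    by (simp_all add: as_module_def)
  have cosI: "z \<in> carrier ?C \<Longrightarrow> w \<in> carrier ?C \<Longrightarrow> z - w \<in> ?K \<Longrightarrow> ?cos z = ?cos w" for z w
    using cos_eq by blast
  have g_hom: "g \<in> ring_hom (as_ring R T) (?C Quot ?K)"
  proof (rule ring_hom_memI)
    fix s t assume "s \<in> carrier (as_ring R T)" "t \<in> carrier (as_ring R T)"
    then have st: "s \<in> T" "t \<in> T" by (simp_all add: T_carrier)
    show "g s \<in> carrier (?C Quot ?K)"
      unfolding g_def using st Ts by (intro ring_hom_closed[OF hom]) (simp add: C_simps)
    have "g (s \<otimes> t) = ?cos (frag_of (s, \<one>) \<otimes>\<^bsub>?C\<^esub> frag_of (t, \<one>))"
      by (simp add: g_def C_simps)
    also have "\<dots> = g s \<otimes>\<^bsub>?C Quot ?K\<^esub> g t"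
      unfolding g_def using st Ts by (intro ring_hom_mult[OF hom]) (simp_all add: C_simps)
    finally show "g (s \<otimes>\<^bsub>as_ring R T\<^esub> t) = g s \<otimes>\<^bsub>?C Quot ?K\<^esub> g t" by (simp add: as_ring_def)
    have "frag_of (s \<oplus> t, \<one>) - (frag_of (s, \<one>) + frag_of (t, \<one>)) \<in> ?K"
      using tensor_relations_add_left[of s ?M t \<one> ?M "as_ring R A"] st Ts(3)
      by (simp only: T_carrier M_simps diff_diff_eq)
    then have "g (s \<oplus> t) = ?cos (frag_of (s, \<one>) \<oplus>\<^bsub>?C\<^esub> frag_of (t, \<one>))"
      unfolding g_def C_simps(2) using st Ts(3,7) by (intro cosI C_add) (simp_all only: C_simps)
    also have "\<dots> = g s \<oplus>\<^bsub>?C Quot ?K\<^esub> g t"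
      unfolding g_def using st Ts by (intro ring_hom_add[OF hom]) (simp_all add: C_simps)
    finally show "g (s \<oplus>\<^bsub>as_ring R T\<^esub> t) = g s \<oplus>\<^bsub>?C Quot ?K\<^esub> g t" by (simp add: as_ring_def)
  next
    have "\<one>\<^bsub>as_ring R T\<^esub> = \<one>" by (simp add: as_ring_def)
    then show "g \<one>\<^bsub>as_ring R T\<^esub> = \<one>\<^bsub>?C Quot ?K\<^esub>"
      using ring_hom_one[OF hom] by (simp add: g_def C_simps)
  qed
  have h_hom: "h \<in> ring_hom (as_ring R T) (?C Quot ?K)"
  proof (rule ring_hom_memI)
    fix s t assume "s \<in> carrier (as_ring R T)" "t \<in> carrier (as_ring R T)"
    then have st: "s \<in> T" "t \<in> T" by (simp_all add: T_carrier)
    show "h s \<in> carrier (?C Quot ?K)"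
      unfolding h_def using st Ts by (intro ring_hom_closed[OF hom]) (simp add: C_simps)
    have "h (s \<otimes> t) = ?cos (frag_of (\<one>, s) \<otimes>\<^bsub>?C\<^esub> frag_of (\<one>, t))"
      by (simp add: h_def C_simps)
    also have "\<dots> = h s \<otimes>\<^bsub>?C Quot ?K\<^esub> h t"
      unfolding h_def using st Ts by (intro ring_hom_mult[OF hom]) (simp_all add: C_simps)
    finally show "h (s \<otimes>\<^bsub>as_ring R T\<^esub> t) = h s \<otimes>\<^bsub>?C Quot ?K\<^esub> h t" by (simp add: as_ring_def)
    have "frag_of (\<one>, s \<oplus> t) - (frag_of (\<one>, s) + frag_of (\<one>, t)) \<in> ?K"
      using tensor_relations_add_right[of \<one> ?M s ?M t "as_ring R A"] st Ts(3)
      by (simp only: T_carrier M_simps diff_diff_eq)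
    then have "h (s \<oplus> t) = ?cos (frag_of (\<one>, s) \<oplus>\<^bsub>?C\<^esub> frag_of (\<one>, t))"
      unfolding h_def C_simps(2) using st Ts(3,7) by (intro cosI C_add) (simp_all only: C_simps)
    also have "\<dots> = h s \<oplus>\<^bsub>?C Quot ?K\<^esub> h t"
      unfolding h_def using st Ts by (intro ring_hom_add[OF hom]) (simp_all add: C_simps)
    finally show "h (s \<oplus>\<^bsub>as_ring R T\<^esub> t) = h s \<oplus>\<^bsub>?C Quot ?K\<^esub> h t" by (simp add: as_ring_def)
  next
    have "\<one>\<^bsub>as_ring R T\<^esub> = \<one>" by (simp add: as_ring_def)
    then show "h \<one>\<^bsub>as_ring R T\<^esub> = \<one>\<^bsub>?C Quot ?K\<^esub>"
      using ring_hom_one[OF hom] by (simp add: h_def C_simps)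
  qed
  have agree: "g a = h a" if a: "a \<in> A" for a
  proof -
    have aT: "a \<in> T" "a \<in> carrier R" using a T(2) Ts(1) by auto
    then have "frag_of (a, \<one>) - frag_of (\<one>, a) \<in> ?K"
      using tensor_relations_smult[of a "as_ring R A" \<one> ?M \<one> ?M] a Ts(3)
      by (simp only: T_carrier M_simps r_one)
    then show ?thesis
      unfolding g_def h_def using aT Ts(3) by (intro cosI) (simp_all only: C_simps)
  qed
  have universal: "\<forall>b\<in>T. g' b = h' b"
    if "cring B" "g' \<in> ring_hom (as_ring R T) B" "h' \<in> ring_hom (as_ring R T) B" "\<forall>a\<in>A. g' a = h' a"
    for B :: "(('a \<times> 'a) \<Rightarrow>\<^sub>0 int) set ring" and g' h'
    using epi that unfolding cring_epimorphism_def T_carrier by blast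
  have "\<forall>b\<in>T. g b = h b"
    using agree by (intro universal[OF cr g_hom h_hom]) blast
  then have "?cos (frag_of (\<one>, x)) = ?cos (frag_of (x, \<one>))"
    using x unfolding g_def h_def by metis
  then show ?thesis using cos_eq[of "frag_of (\<one>, x)" "frag_of (x, \<one>)"] x Ts(3)
    by (simp only: C_simps)
qed

text \<open>
  This is \<open>J T = T\<close> for \<open>J = {r \<in> A. r x \<in> A}\<close>; quantifying over the additive subgroups \<open>D\<close> that
  contain the products \<open>r t\<close> avoids finite sums of such products.

  Put \<open>N = A + A x\<close>.  In \<open>T \<otimes> T\<close> the elements \<open>1 \<otimes> x\<close> and \<open>x \<otimes> 1\<close> are equal because the
  extension is an epimorphism, and by flatness they are already equal in \<open>T \<otimes> N\<close>.  The rule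
  \<open>t \<otimes> (a + b x) \<mapsto> b t\<close> is well defined modulo \<open>D\<close>, since \<open>b\<close> is determined up to an element of
  \<open>J\<close>; it sends \<open>1 \<otimes> x\<close> to \<open>1\<close> and \<open>x \<otimes> 1\<close> to \<open>0\<close>.
\<close>

lemma flat_epimorphism_conductor:
  assumes A: "subring A R" and T: "subring T R" "A \<subseteq> T"
    and fe: "flat_epimorphic R A T"
    and x: "x \<in> T" and D: "subgroup D (add_monoid R)"
    and JD: "\<And>r t. r \<in> A \<Longrightarrow> r \<otimes> x \<in> A \<Longrightarrow> t \<in> T \<Longrightarrow> r \<otimes> t \<in> D"
  shows "\<one> \<in> D"
proof -
  let ?A = "as_ring R A" and ?M = "as_module R T"
  note As = subringE[OF A] and Ts = subringE[OF T(1)]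
  have AC [simp]: "a \<in> carrier R" if "a \<in> A" for a using As(1) that by blast
  have TC [simp]: "a \<in> carrier R" if "a \<in> T" for a using Ts(1) that by blast
  have xC [simp]: "x \<in> carrier R" using x by simp
  define N where "N = {a \<oplus> b \<otimes> x | a b. a \<in> A \<and> b \<in> A}"
  have NI: "a \<oplus> b \<otimes> x \<in> N" if "a \<in> A" "b \<in> A" for a b using that by (auto simp: N_def)
  have N_sub: "subgroup N (add_monoid R)"
  proof (rule add.subgroupI)
    show "N \<subseteq> carrier R" by (auto simp: N_def)
    show "N \<noteq> {}" using NI As(2) by blast
    fix u assume "u \<in> N"
    then obtain a b where u: "a \<in> A" "b \<in> A" "u = a \<oplus> b \<otimes> x" by (auto simp: N_def)
    have "\<ominus> u = (\<ominus> a) \<oplus> (\<ominus> b) \<otimes> x" using u by (simp add: minus_add l_minus)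
    then show "\<ominus> u \<in> N" using NI u As(5) by simp
    fix v assume "v \<in> N"
    then obtain c d where v: "c \<in> A" "d \<in> A" "v = c \<oplus> d \<otimes> x" by (auto simp: N_def)
    have "u \<oplus> v = (a \<oplus> c) \<oplus> (b \<oplus> d) \<otimes> x" using u v by (simp add: l_distr a_ac)
    then show "u \<oplus> v \<in> N" using NI u v As(7) by simp
  qed
  have AN: "a \<otimes> n \<in> N" if "a \<in> A" "n \<in> N" for a n
  proof -
    obtain c d where n: "c \<in> A" "d \<in> A" "n = c \<oplus> d \<otimes> x" using \<open>n \<in> N\<close> by (auto simp: N_def)
    have "a \<otimes> n = (a \<otimes> c) \<oplus> (a \<otimes> d) \<otimes> x" using n that by (simp add: r_distr m_assoc)
    then show ?thesis using NI n that As(6) by simp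
  qed
  have NT: "N \<subseteq> T" using T(2) Ts(6,7) x by (auto simp: N_def subset_iff)
  then have NC [simp]: "n \<in> carrier R" if "n \<in> N" for n using that by auto
  have oneN: "\<one> \<in> N" using NI[of \<one> \<zero>] As(2,3) by simp
  have xN: "x \<in> N" using NI[of \<zero> \<one>] As(2,3) by simp
  \<comment> \<open>Any injection of \<open>'a\<close> into the type of test objects would do for the transport.\<close>
  define e :: "'a \<Rightarrow> 'a test" where "e a = {frag_of (a, a)}" for a
  have e: "inj e" by (auto simp: inj_def e_def frag_of_eq)
  have M: "module ?A ?M"
    using T Ts(6) by (intro module_as_module A) (auto simp: subring_def)
  have N: "module ?A (module_copy e (as_module R N))"
    by (intro module_module_copy module_as_module A N_sub AN e)
  have M': "module ?A (module_copy e ?M)" by (rule module_module_copy[OF M e])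
  let ?N = "module_copy e (as_module R N)" and ?T = "module_copy e ?M"
  have flat: "flat_module TYPE('a test) ?A ?M"
    and epi: "cring_epimorphism TYPE('a test) ?A (as_ring R T) (\<lambda>x. x)"
    using fe by (simp_all add: flat_epimorphic_def)
  define z where "z = frag_of (\<one>, e x) - frag_of (x, e \<one>)"
  have z_keys: "Poly_Mapping.keys z \<subseteq> carrier ?M \<times> carrier ?N"
    using x oneN xN Ts(3) unfolding z_def
    by (intro keys_frag_diff) (auto simp: as_module_def module_copy_def)
  have "frag_extend (\<lambda>(x, y). frag_of (x, e y)) (frag_of (\<one>, x) - frag_of (x, \<one>)) \<in> tensor_relations ?A ?M ?T"
    by (rule tensor_relations_functorial[OF M M M' module_copy_hom[OF e]
          epimorphism_tensor_symmetric[OF A T epi x]])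
  then have zT: "z \<in> tensor_relations ?A ?M ?T" by (simp add: z_def frag_extend_diff)
  have zN: "z \<in> tensor_relations ?A ?M ?N"
  proof (rule flat_module_reflects_relations[OF flat N M' _ _ z_keys])
    show "(\<lambda>y. y) \<in> module_hom ?A ?N ?T"
      using NT by (auto simp: module_hom_def module_copy_def as_module_def)
    show "frag_extend (\<lambda>(x, y). frag_of (x, y)) z \<in> tensor_relations ?A ?M ?T"
    proof -
      have "(\<lambda>(x, y). frag_of (x, y)) = (frag_of :: 'a \<times> 'a test \<Rightarrow> _)" by auto
      then show ?thesis using zT frag_expansion[of z] by metis
    qed
  qed simp
  \<comment> \<open>A choice of the coefficient of \<open>x\<close> turns the rule into a function; it is additive only modulo
    \<open>D\<close>, so what is proved of the induced map \<open>\<psi>\<close> is that it sends relations into \<open>D\<close>.\<close>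
  define b where "b n = (SOME d. d \<in> A \<and> n \<ominus> d \<otimes> x \<in> A)" for n
  have b: "b n \<in> A \<and> n \<ominus> b n \<otimes> x \<in> A" if "n \<in> N" for n
  proof -
    obtain c d where n: "c \<in> A" "d \<in> A" "n = c \<oplus> d \<otimes> x" using \<open>n \<in> N\<close> by (auto simp: N_def)
    then have "n \<ominus> d \<otimes> x = c" by (simp add: a_minus_def a_assoc r_neg)
    with n have "d \<in> A \<and> n \<ominus> d \<otimes> x \<in> A" by simp
    then show ?thesis unfolding b_def by (rule someI)
  qed
  have bA: "b n \<in> A" if "n \<in> N" for n using b that by blast
  have b_cong: "(b n \<ominus> d) \<otimes> t \<in> D" if n: "n \<in> N" and d: "d \<in> A" "n \<ominus> d \<otimes> x \<in> A" and t: "t \<in> T" for n d t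
  proof (rule JD[OF _ _ t])
    show "b n \<ominus> d \<in> A" using bA[OF n] d As by (simp add: a_minus_def)
    have "(b n \<ominus> d) \<otimes> x = (n \<ominus> d \<otimes> x) \<ominus> (n \<ominus> b n \<otimes> x)"
      using bA[OF n] d n x by (simp add: a_minus_def l_distr l_minus minus_add minus_minus a_ac r_neg1 r_neg2 r_neg)
    then show "(b n \<ominus> d) \<otimes> x \<in> A" using b[OF n] d As by (simp add: a_minus_def)
  qed
  have D_add: "u \<oplus> v \<in> D" if "u \<in> D" "v \<in> D" for u v using subgroup.m_closed[OF D] that by simp
  have D_minus: "\<ominus> u \<in> D" if "u \<in> D" for u using subgroup.m_inv_closed[OF D] that by (simp add: a_inv_def)
  have DC [simp]: "u \<in> carrier R" if "u \<in> D" for u using subgroup.subset[OF D] that by auto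
  obtain \<psi> where \<psi>_hom: "\<psi> \<in> hom (free_Abelian_group (carrier ?M \<times> carrier ?N)) (add_monoid R)"
    and \<psi>0: "\<And>w. w \<in> carrier ?M \<times> carrier ?N \<Longrightarrow> \<psi> (frag_of w) = (\<lambda>(t, u). b (inv_into UNIV e u) \<otimes> t) w"
  proof (rule comm_group.free_Abelian_group_universal[OF a_comm_group, of "\<lambda>(t, u). b (inv_into UNIV e u) \<otimes> t" "carrier ?M \<times> carrier ?N"])
    show "(\<lambda>(t, u). b (inv_into UNIV e u) \<otimes> t) ` (carrier ?M \<times> carrier ?N) \<subseteq> carrier (add_monoid R)"
      using bA by (auto simp: as_module_def module_copy_def e)
  qed blast
  have \<psi>: "\<psi> (frag_of (t, e n)) = b n \<otimes> t" if "t \<in> T" "n \<in> N" for t n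
    using \<psi>0[of "(t, e n)"] that by (auto simp: as_module_def module_copy_def e)
  let ?F = "free_Abelian_group (carrier ?M \<times> carrier ?N)"
  interpret \<psi>: group_hom ?F "add_monoid R" \<psi>
    by (intro group_hom.intro group_hom_axioms.intro \<psi>_hom group_free_Abelian_group a_group)
  have \<psi>_diff: "\<psi> (v - w) = \<psi> v \<ominus> \<psi> w"
    if v: "Poly_Mapping.keys v \<subseteq> carrier ?M \<times> carrier ?N" and w: "Poly_Mapping.keys w \<subseteq> carrier ?M \<times> carrier ?N" for v w
  proof -
    have "\<psi> (v \<otimes>\<^bsub>?F\<^esub> inv\<^bsub>?F\<^esub> w) = \<psi> v \<oplus> \<ominus> \<psi> w"
      using \<psi>.hom_mult[of v "inv\<^bsub>?F\<^esub> w"] \<psi>.hom_inv[of w] v w by (simp add: a_inv_def)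
    then show ?thesis using w by (simp add: a_minus_def)
  qed
  have MN: "carrier ?M = T" "carrier ?N = e ` N" by (simp_all add: as_module_def module_copy_def)
  have \<psi>_diff1: "\<psi> (frag_of (t, e n) - frag_of (t', e n')) = b n \<otimes> t \<ominus> b n' \<otimes> t'"
    if "t \<in> T" "n \<in> N" "t' \<in> T" "n' \<in> N" for t n t' n'
    using that by (subst \<psi>_diff) (auto simp: MN \<psi>)
  have \<psi>_diff2: "\<psi> (frag_of (t, e n) - frag_of (t', e n') - frag_of (t'', e n'')) = b n \<otimes> t \<ominus> b n' \<otimes> t' \<ominus> b n'' \<otimes> t''"
    if "t \<in> T" "n \<in> N" "t' \<in> T" "n' \<in> N" "t'' \<in> T" "n'' \<in> N" for t n t' n' t'' n''
  proof -
    have "Poly_Mapping.keys (frag_of (t, e n) - frag_of (t', e n')) \<subseteq> carrier ?M \<times> carrier ?N"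
      using that by (intro keys_frag_diff) (auto simp: MN)
    then show ?thesis using that by (subst \<psi>_diff) (auto simp: MN \<psi> \<psi>_diff1)
  qed
  have "\<psi> z \<in> D"
    using M N zN
  proof (induction rule: tensor_relations_induct)
    case zero
    then show ?case using \<psi>.hom_one subgroup.one_closed[OF D] by simp
  next
    case (diff v w)
    then show ?case
      using tensor_relations_carrier[OF M N] D_add D_minus by (simp add: \<psi>_diff a_minus_def)
  next
    case (add_left s t u)
    then obtain n where n: "s \<in> T" "t \<in> T" "n \<in> N" "u = e n" by (auto simp: MN)
    have "b n \<otimes> (s \<oplus> t) \<ominus> b n \<otimes> s \<ominus> b n \<otimes> t = \<zero>"
      using n bA[OF n(3)]
      by (simp add: r_distr a_minus_def a_comm[of "b n \<otimes> s" "b n \<otimes> t"] a_assoc r_neg r_neg2)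
    then show ?case
      using n Ts(7) \<psi>_diff2[of "s \<oplus> t" n s n t n] subgroup.one_closed[OF D]
      by (simp add: as_module_def)
  next
    case (add_right t u v)
    then obtain n m where n: "t \<in> T" "n \<in> N" "u = e n" "m \<in> N" "v = e m" by (auto simp: MN)
    have nm: "n \<oplus> m \<in> N" using subgroup.m_closed[OF N_sub] n by simp
    note [simp] = bA[OF n(2)] bA[OF n(4)] bA[OF nm]
    have "(n \<oplus> m) \<ominus> (b n \<oplus> b m) \<otimes> x = (n \<ominus> b n \<otimes> x) \<oplus> (m \<ominus> b m \<otimes> x)"
      using n by (simp add: l_distr a_minus_def minus_add a_ac)
    then have "(b (n \<oplus> m) \<ominus> (b n \<oplus> b m)) \<otimes> t \<in> D"
      using b[OF n(2)] b[OF n(4)] As(7) by (intro b_cong nm n) simp_all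
    moreover have "(c \<ominus> (b n \<oplus> b m)) \<otimes> t = c \<otimes> t \<ominus> b n \<otimes> t \<ominus> b m \<otimes> t" if "c \<in> carrier R" for c
      using n that by (simp add: l_distr a_minus_def minus_add l_minus a_ac)
    ultimately show ?case
      using n nm \<psi>_diff2[of t "n \<oplus> m" t n t m] by (simp add: as_module_def module_copy_def e)
  next
    case (smult r t u)
    then obtain n where n: "r \<in> A" "t \<in> T" "n \<in> N" "u = e n" by (auto simp: MN as_ring_def)
    have rn: "r \<otimes> n \<in> N" using AN n by simp
    have rt: "r \<otimes> t \<in> T" using n T(2) Ts(6) by blast
    note [simp] = bA[OF n(3)] bA[OF rn]
    have "(r \<otimes> n) \<ominus> (r \<otimes> b n) \<otimes> x = r \<otimes> (n \<ominus> b n \<otimes> x)"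
      using n by (simp add: r_distr a_minus_def r_minus m_assoc)
    then have "(b (r \<otimes> n) \<ominus> r \<otimes> b n) \<otimes> t \<in> D"
      using b[OF n(3)] As(6) n by (intro b_cong rn) simp_all
    from D_minus[OF this] have "\<ominus> ((b (r \<otimes> n) \<ominus> r \<otimes> b n) \<otimes> t) \<in> D" .
    moreover have "\<ominus> ((c \<ominus> r \<otimes> b n) \<otimes> t) = b n \<otimes> (r \<otimes> t) \<ominus> c \<otimes> t" if "c \<in> carrier R" for c
      using n that by (simp add: l_distr r_distr a_minus_def minus_add l_minus r_minus minus_minus m_ac a_ac)
    ultimately show ?case
      using n rn rt \<psi>_diff1[of "r \<otimes> t" n t "r \<otimes> n"] by (simp add: as_module_def module_copy_def e)
  qed
  moreover have "\<psi> z = b x \<ominus> b \<one> \<otimes> x"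
    unfolding z_def using \<psi>_diff1[of \<one> x x \<one>] xN oneN x Ts(3) bA by simp
  ultimately have 1: "b x \<ominus> b \<one> \<otimes> x \<in> D" by simp
  have 2: "b \<one> \<otimes> x \<in> D"
    using b_cong[OF oneN As(2) _ x] As(3) bA[OF oneN] by (simp add: a_minus_def)
  have 3: "b x \<ominus> \<one> \<in> D"
    using b_cong[OF xN As(3) _ Ts(3)] As(2,3) bA[OF xN] by (simp add: a_minus_def r_neg)
  have "\<one> = (b x \<ominus> b \<one> \<otimes> x) \<oplus> b \<one> \<otimes> x \<oplus> \<ominus> (b x \<ominus> \<one>)"
    using bA[OF xN] bA[OF oneN] by (simp add: a_minus_def minus_add minus_minus a_ac r_neg r_neg1 r_neg2)
  then show ?thesis using D_add[OF D_add[OF 1 2] D_minus[OF 3]] by simp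
qed

end

section \<open>Localisation at a prime of the small ring\<close>

lemma (in cring) proper_ideal_in_prime_ideal:
  assumes "ideal I R" "\<one> \<notin> I"
  shows "\<exists>p. primeideal p R \<and> I \<subseteq> p"
proof -
  define F where "F = {J. ideal J R \<and> I \<subseteq> J \<and> \<one> \<notin> J}"
  have "\<exists>M\<in>F. \<forall>J\<in>F. M \<subseteq> J \<longrightarrow> J = M"
  proof (rule subset_Zorn_nonempty)
    show "F \<noteq> {}" using assms by (auto simp: F_def)
  next
    fix C assume C: "C \<noteq> {}" "subset.chain F C"
    then have CF: "C \<subseteq> F" by (auto simp: pred_on.chain_def)
    have "subset.chain {J. ideal J R} C"
      using C by (auto simp: pred_on.chain_def F_def)
    from chain_Union_is_ideal[OF this] C(1) have "ideal (\<Union>C) R" by simp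
    then show "\<Union>C \<in> F" using CF C(1) by (auto simp: F_def)
  qed
  then obtain M where M: "M \<in> F" "\<And>J. J \<in> F \<Longrightarrow> M \<subseteq> J \<Longrightarrow> J = M" by blast
  have "maximalideal M R"
  proof (rule maximalidealI)
    show "ideal M R" "carrier R \<noteq> M" using M(1) by (auto simp: F_def)
    fix J assume J: "ideal J R" "M \<subseteq> J" "J \<subseteq> carrier R"
    then show "J = M \<or> J = carrier R"
    proof (cases "\<one> \<in> J")
      case False
      then have "J \<in> F" using J M(1) by (auto simp: F_def)
      then show ?thesis using M(2) J(2) by blast
    qed (use ideal.one_imp_carrier[OF J(1)] in blast)
  qed
  then show ?thesis
    using M(1) maximalideal_prime by (auto simp: F_def)
qed

locale ring_ext = cring S for S (structure) +
  fixes R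
  assumes subring_R: "subring R S"
begin

lemmas R_closed = subringE[OF subring_R]

lemma R_carrier [simp, intro]: "r \<in> R \<Longrightarrow> r \<in> carrier S"
  using R_closed(1) by blast

lemma add_diff_cancel_left: "a \<in> carrier S \<Longrightarrow> b \<in> carrier S \<Longrightarrow> (a \<oplus> b) \<ominus> a = b"
  by (simp add: a_minus_def a_comm[of a b] a_assoc r_neg)

lemma intermediateD:
  assumes "W \<in> intermediate_rings R S"
  shows "subring W S" "R \<subseteq> W" "W \<subseteq> carrier S"
  using assms subringE(1) by (auto simp: intermediate_rings_def)

definition conductor :: "'a set \<Rightarrow> 'a \<Rightarrow> 'a set"
  where "conductor W x = {r \<in> R. r \<otimes> x \<in> W}"

text \<open>
  The condition \<open>(R : x) T = T\<close> on all intermediate rings \<open>T\<close>, with \<open>D\<close> in place of the ideal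
  \<open>(R : x) T\<close> as in \<open>flat_epimorphism_conductor\<close>.  It carries the whole strength of the Pruefer
  hypothesis in the arguments that follow.
\<close>

definition conductors_dense :: bool
  where "conductors_dense \<longleftrightarrow> (\<forall>T\<in>intermediate_rings R S. \<forall>x\<in>T. \<forall>D.
     subgroup D (add_monoid S) \<longrightarrow> (\<forall>r\<in>conductor R x. \<forall>t\<in>T. r \<otimes> t \<in> D) \<longrightarrow> \<one> \<in> D)"

end

locale prime_of_ring_ext = ring_ext S R for S (structure) and R +
  fixes p
  assumes prime_p: "primeideal p (as_ring S R)"
begin

lemma p_sub: "r \<in> p \<Longrightarrow> r \<in> R"
  using ideal.Icarr[OF primeideal.axioms(1)[OF prime_p]] by (simp add: as_ring_def)

lemma p_carrier [simp, intro]: "r \<in> p \<Longrightarrow> r \<in> carrier S"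
  using p_sub by blast

lemma additive_subgroup_p: "additive_subgroup p (as_ring S R)"
  using prime_p ideal.axioms(1) primeideal.axioms(1) by blast

lemma p_zero: "\<zero> \<in> p"
  using additive_subgroup.zero_closed[OF additive_subgroup_p] by (simp add: as_ring_def)

lemma p_add: "a \<in> p \<Longrightarrow> b \<in> p \<Longrightarrow> a \<oplus> b \<in> p"
  using additive_subgroup.a_closed[OF additive_subgroup_p] by (simp add: as_ring_def)

lemma p_mult: "r \<in> R \<Longrightarrow> a \<in> p \<Longrightarrow> r \<otimes> a \<in> p"
  using ideal.I_l_closed[OF primeideal.axioms(1)[OF prime_p], of a r] by (simp add: as_ring_def)

lemma p_uminus: "a \<in> p \<Longrightarrow> \<ominus> a \<in> p"
  using p_mult[of "\<ominus> \<one>" a] R_closed(3,5) by (simp add: l_minus)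

lemma p_one: "\<one> \<notin> p"
proof
  assume "\<one> \<in> p"
  then have "p = R"
    using ideal.one_imp_carrier[OF primeideal.axioms(1)[OF prime_p]] by (simp add: as_ring_def)
  then show False using primeideal.I_notcarr[OF prime_p] by (simp add: as_ring_def)
qed

lemma outside_mult: "a \<in> R - p \<Longrightarrow> b \<in> R - p \<Longrightarrow> a \<otimes> b \<in> R - p"
  using primeideal.I_prime[OF prime_p, of a b] R_closed(6) by (auto simp: as_ring_def)

lemma outside_diff: "a \<in> R - p \<Longrightarrow> b \<in> p \<Longrightarrow> a \<ominus> b \<in> R - p"
proof -
  assume a: "a \<in> R - p" and b: "b \<in> p"
  have "a \<ominus> b \<in> R" using a b R_closed p_sub by (simp add: minus_eq)
  moreover have "a = (a \<ominus> b) \<oplus> b" using a b by (auto simp: a_minus_def a_assoc l_neg)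
  ultimately show ?thesis using p_add[of "a \<ominus> b" b] a b by auto
qed

text \<open>
  The localisation of \<open>V\<close> at \<open>p\<close> is represented by its trace on \<open>S\<close>, that is, by the elements of \<open>S\<close>
  with a denominator outside \<open>p\<close>.  Thus every localisation is again a subset of \<open>S\<close>, and there
  are no fractions to be identified.
\<close>

definition localisation :: "'a set \<Rightarrow> 'a set"
  where "localisation V = {s \<in> carrier S. \<exists>r\<in>R - p. r \<otimes> s \<in> V}"

lemma localisationE:
  assumes "s \<in> localisation V"
  obtains r where "r \<in> R - p" "r \<otimes> s \<in> V" "s \<in> carrier S"
  using assms by (auto simp: localisation_def)

lemma localisationI: "s \<in> carrier S \<Longrightarrow> r \<in> R - p \<Longrightarrow> r \<otimes> s \<in> V \<Longrightarrow> s \<in> localisation V"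
  by (auto simp: localisation_def)

lemma localisation_incl: "V \<subseteq> carrier S \<Longrightarrow> V \<subseteq> localisation V"
  using p_one R_closed(3) by (auto intro!: localisationI[of _ \<one>])

lemma subring_localisation:
  assumes "V \<in> intermediate_rings R S"
  shows "subring (localisation V) S"
proof (rule subringI)
  note V = subringE[OF intermediateD(1)[OF assms]] and RV = intermediateD(2)[OF assms]
  show "localisation V \<subseteq> carrier S" by (auto simp: localisation_def)
  show "\<one> \<in> localisation V" using localisation_incl V(1,3) by blast
  fix h assume h: "h \<in> localisation V"
  then obtain r where r: "r \<in> R - p" "r \<otimes> h \<in> V" "h \<in> carrier S" by (rule localisationE)
  then have "r \<otimes> (\<ominus> h) \<in> V" using V(5)[of "r \<otimes> h"] by (auto simp: r_minus)
  with r show "\<ominus> h \<in> localisation V" by (blast intro: localisationI a_inv_closed)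
  fix k assume "k \<in> localisation V"
  then obtain q where q: "q \<in> R - p" "q \<otimes> k \<in> V" "k \<in> carrier S" by (rule localisationE)
  have rq: "r \<otimes> q \<in> R - p" using outside_mult r q by blast
  have [simp]: "r \<in> carrier S" "q \<in> carrier S" using r q by auto
  have rqV: "r \<in> V" "q \<in> V" using RV r q by auto
  have "(r \<otimes> q) \<otimes> (h \<otimes> k) = (r \<otimes> h) \<otimes> (q \<otimes> k)" using r q by (simp add: m_ac)
  with r q V(6) have "(r \<otimes> q) \<otimes> (h \<otimes> k) \<in> V" by simp
  with rq r q show "h \<otimes> k \<in> localisation V" by (blast intro: localisationI m_closed)
  have "(r \<otimes> q) \<otimes> (h \<oplus> k) = q \<otimes> (r \<otimes> h) \<oplus> r \<otimes> (q \<otimes> k)" using r q by (simp add: m_ac r_distr)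
  with r q V(6,7) rqV have "(r \<otimes> q) \<otimes> (h \<oplus> k) \<in> V" by simp
  with rq r q show "h \<oplus> k \<in> localisation V" by (blast intro: localisationI a_closed)
qed

section \<open>Values of polynomials with coefficients in the prime\<close>

text \<open>
  The values at \<open>x\<close> of polynomials of degree at most \<open>n\<close> with all coefficients in \<open>p\<close>, built by
  the Horner scheme.
\<close>

primrec poly_values :: "'a \<Rightarrow> nat \<Rightarrow> 'a set" where
  "poly_values x 0 = p"
| "poly_values x (Suc n) = {c \<oplus> x \<otimes> g | c g. c \<in> p \<and> g \<in> poly_values x n}"

lemma poly_values_SucI: "c \<in> p \<Longrightarrow> g \<in> poly_values x n \<Longrightarrow> c \<oplus> x \<otimes> g \<in> poly_values x (Suc n)"
  by auto

context
  fixes x assumes x [simp]: "x \<in> carrier S"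
begin

lemma poly_values_carrier [simp, intro]: "g \<in> poly_values x n \<Longrightarrow> g \<in> carrier S"
  by (induction n arbitrary: g) auto

lemma poly_values_zero: "\<zero> \<in> poly_values x n"
proof (induction n)
  case (Suc n)
  show ?case using poly_values_SucI[OF p_zero Suc] by simp
qed (simp add: p_zero)

lemma poly_values_add: "f \<in> poly_values x n \<Longrightarrow> g \<in> poly_values x n \<Longrightarrow> f \<oplus> g \<in> poly_values x n"
proof (induction n arbitrary: f g)
  case (Suc n)
  then obtain c d f' g' where *: "c \<in> p" "d \<in> p" "f' \<in> poly_values x n" "g' \<in> poly_values x n"
    "f = c \<oplus> x \<otimes> f'" "g = d \<oplus> x \<otimes> g'" by auto
  then have "f \<oplus> g = (c \<oplus> d) \<oplus> x \<otimes> (f' \<oplus> g')" by (simp add: r_distr a_ac)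
  moreover have "c \<oplus> d \<in> p" "f' \<oplus> g' \<in> poly_values x n" using * Suc.IH p_add by auto
  ultimately show ?case by auto
qed (simp add: p_add)

lemma poly_values_mult: "r \<in> R \<Longrightarrow> g \<in> poly_values x n \<Longrightarrow> r \<otimes> g \<in> poly_values x n"
proof (induction n arbitrary: g)
  case (Suc n)
  then obtain c f' where *: "c \<in> p" "f' \<in> poly_values x n" "g = c \<oplus> x \<otimes> f'" by auto
  then have "r \<otimes> g = (r \<otimes> c) \<oplus> x \<otimes> (r \<otimes> f')" using Suc.prems by (simp add: r_distr m_ac)
  moreover have "r \<otimes> c \<in> p" "r \<otimes> f' \<in> poly_values x n" using * Suc p_mult by auto
  ultimately show ?case by auto
qed (simp add: p_mult)

lemma poly_values_Suc_mono: "poly_values x n \<subseteq> poly_values x (Suc n)"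
proof (induction n)
  case 0
  have "c \<in> poly_values x (Suc 0)" if "c \<in> p" for c
    using poly_values_SucI[OF that poly_values_zero[of 0]] that by simp
  then show ?case by auto
next
  case (Suc n)
  then show ?case by auto
qed

lemma poly_values_mono: "m \<le> n \<Longrightarrow> poly_values x m \<subseteq> poly_values x n"
  using poly_values_Suc_mono by (rule lift_Suc_mono_le)

text \<open>
  The Horner scheme peels off the constant term; splitting off the term of highest degree
  instead is what allows the degree to be lowered.
\<close>

lemma poly_values_top:
  assumes "g \<in> poly_values x (Suc n)"
  shows "\<exists>a c. a \<in> poly_values x n \<and> c \<in> p \<and> g = a \<oplus> c \<otimes> x [^] Suc n"
  using assms
proof (induction n arbitrary: g)
  case 0
  then obtain c d where "c \<in> p" "d \<in> p" "g = c \<oplus> x \<otimes> d" by auto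
  then have "c \<in> poly_values x 0 \<and> d \<in> p \<and> g = c \<oplus> d \<otimes> x [^] Suc 0" by (simp add: m_comm)
  then show ?case by blast
next
  case (Suc n)
  then obtain c f where f: "c \<in> p" "f \<in> poly_values x (Suc n)" "g = c \<oplus> x \<otimes> f" by auto
  with Suc.IH obtain a d where ad: "a \<in> poly_values x n" "d \<in> p" "f = a \<oplus> d \<otimes> x [^] Suc n" by blast
  have "g = (c \<oplus> x \<otimes> a) \<oplus> d \<otimes> x [^] Suc (Suc n)"
    using f(1,3) ad by (simp add: r_distr a_ac m_ac)
  moreover have "c \<oplus> x \<otimes> a \<in> poly_values x (Suc n)" using f ad by auto
  ultimately show ?case using ad by blast
qed

lemma poly_values_power: "c \<in> p \<Longrightarrow> c \<otimes> x [^] n \<in> poly_values x n"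
proof (induction n)
  case (Suc n)
  have "c \<otimes> x [^] Suc n = \<zero> \<oplus> x \<otimes> (c \<otimes> x [^] n)" using Suc.prems by (simp add: m_ac)
  with poly_values_SucI[OF p_zero Suc.IH[OF Suc.prems]] show ?case by simp
qed simp

end

text \<open>
  If \<open>x y\<close> is a scalar \<open>s \<in> R\<close>, multiplication by \<open>x\<^sup>n\<close> turns each \<open>y\<^sup>i\<close> with \<open>i \<le> n\<close> into
  \<open>s\<^sup>i x\<^sup>n\<^sup>-\<^sup>i\<close>, so it reverses the order of the powers.
\<close>

lemma poly_values_reverse:
  assumes x: "x \<in> carrier S" and y: "y \<in> carrier S" and s: "x \<otimes> y \<in> R"
  shows "g \<in> poly_values y n \<Longrightarrow> g \<otimes> x [^] n \<in> poly_values x n"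
proof (induction n arbitrary: g)
  case (Suc n)
  then obtain c f where f: "c \<in> p" "f \<in> poly_values y n" "g = c \<oplus> y \<otimes> f" by auto
  note [simp] = poly_values_carrier[OF y f(2)] x y
  have "g \<otimes> x [^] Suc n = c \<otimes> x [^] Suc n \<oplus> (x \<otimes> y) \<otimes> (f \<otimes> x [^] n)"
    using f(1,3) by (simp add: l_distr r_distr m_ac)
  moreover have "c \<otimes> x [^] Suc n \<in> poly_values x (Suc n)" using poly_values_power f x by blast
  moreover have "(x \<otimes> y) \<otimes> (f \<otimes> x [^] n) \<in> poly_values x (Suc n)"
    using poly_values_mult[OF x s] Suc.IH[OF f(2)] poly_values_Suc_mono[OF x] by blast
  ultimately show ?case
    using poly_values_add[OF x, of "c \<otimes> x [^] Suc n" "Suc n" "(x \<otimes> y) \<otimes> (f \<otimes> x [^] n)"]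
    by (simp only:)
qed simp

text \<open>
  The step by which one shows classically that an element or its inverse belongs to a valuation
  ring.  A polynomial relation for \<open>y\<close>, multiplied by a power of \<open>x\<close>, expresses a multiple \<open>w x\<^sup>n\<^sup>+\<^sup>1\<close>
  with \<open>w\<close> outside \<open>p\<close> by lower powers of \<open>x\<close>, and this eliminates the leading term of the
  relation for \<open>x\<close>.
\<close>

lemma degree_reduction:
  assumes x: "x \<in> carrier S" and y: "y \<in> carrier S" and s: "x \<otimes> y \<in> R"
    and f: "f \<in> poly_values x (Suc n)" "f \<in> R - p"
    and g: "g \<in> poly_values y (Suc k)" "g \<in> R - p"
    and kn: "k \<le> n"
  shows "\<exists>h\<in>poly_values x n. h \<in> R - p"
proof -
  note [simp] = x y
  obtain q u where u: "q \<in> p" "u \<in> poly_values y k" "g = q \<oplus> y \<otimes> u" using g by auto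
  then have un: "u \<in> poly_values y n" using poly_values_mono[OF y kn] by blast
  have [simp]: "u \<in> carrier S" "q \<in> carrier S" using poly_values_carrier[OF y un] u by auto
  obtain a c where a: "a \<in> poly_values x n" "c \<in> p" "f = a \<oplus> c \<otimes> x [^] Suc n"
    using poly_values_top[OF x f(1)] by blast
  have [simp]: "a \<in> carrier S" "c \<in> carrier S" using poly_values_carrier[OF x] a by auto
  define w where "w = g \<ominus> q"
  have w: "w \<in> R - p" unfolding w_def using g(2) u(1) by (rule outside_diff)
  have wu: "w = y \<otimes> u" using u(3) add_diff_cancel_left by (simp add: w_def)
  have "w \<otimes> f = w \<otimes> a \<oplus> (c \<otimes> (x \<otimes> y)) \<otimes> (u \<otimes> x [^] n)"
    unfolding wu a(3) by (simp add: r_distr m_ac)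
  moreover have "w \<otimes> a \<in> poly_values x n" using poly_values_mult[OF x] w a by blast
  moreover have "(c \<otimes> (x \<otimes> y)) \<otimes> (u \<otimes> x [^] n) \<in> poly_values x n"
    using poly_values_mult[OF x] poly_values_reverse[OF x y s un] R_closed(6) s p_sub[OF a(2)] by blast
  ultimately have "w \<otimes> f \<in> poly_values x n" using poly_values_add[OF x] by simp
  moreover have "w \<otimes> f \<in> R - p" using outside_mult w f by blast
  ultimately show ?thesis by blast
qed

text \<open>
  Since \<open>(R : x) \<subseteq> p\<close>, every intermediate ring \<open>T\<close> containing \<open>x\<close> satisfies \<open>p T = T\<close>.  Instead of \<open>T = R[x]\<close>, for which
  one would have to describe the elements of \<open>T\<close> as polynomials in \<open>x\<close>, take for \<open>T\<close> the ring of all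
  elements of \<open>S\<close> that multiply the set \<open>Q = p[x]\<close> into itself.  It contains \<open>R\<close> and \<open>x\<close>, and
  \<open>p T \<subseteq> Q\<close> because \<open>p \<subseteq> Q\<close>.
\<close>

lemma one_in_poly_values:
  assumes dense: conductors_dense
    and x: "x \<in> carrier S" and c: "conductor R x \<subseteq> p"
  shows "\<exists>n. \<one> \<in> poly_values x n"
proof -
  note [simp] = x
  define Q where "Q = (\<Union>n. poly_values x n)"
  define T where "T = {t \<in> carrier S. \<forall>q\<in>Q. t \<otimes> q \<in> Q}"
  have Q_carrier [simp]: "q \<in> carrier S" if "q \<in> Q" for q using that poly_values_carrier[OF x] by (auto simp: Q_def)
  have Q_add: "a \<oplus> b \<in> Q" if "a \<in> Q" "b \<in> Q" for a b
  proof -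
    obtain m n where "a \<in> poly_values x m" "b \<in> poly_values x n" using \<open>a \<in> Q\<close> \<open>b \<in> Q\<close> by (auto simp: Q_def)
    then have "a \<in> poly_values x (max m n)" "b \<in> poly_values x (max m n)"
      using poly_values_mono[OF x, of m "max m n"] poly_values_mono[OF x, of n "max m n"] by auto
    then show ?thesis using poly_values_add[OF x] by (auto simp: Q_def)
  qed
  have Q_mult: "r \<otimes> a \<in> Q" if "r \<in> R" "a \<in> Q" for r a
    using that poly_values_mult[OF x] by (auto simp: Q_def)
  have Q_uminus: "\<ominus> a \<in> Q" if "a \<in> Q" for a
    using Q_mult[OF _ that, of "\<ominus> \<one>"] that R_closed(3,5) by (simp add: l_minus)
  have Q_zero: "\<zero> \<in> Q" using poly_values_zero[OF x] by (auto simp: Q_def)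
  have Q_sub: "subgroup Q (add_monoid S)"
    by (rule add.subgroupI) (use Q_add Q_uminus Q_zero in \<open>auto simp: a_inv_def\<close>)
  have Q_x: "x \<otimes> a \<in> Q" if "a \<in> Q" for a
  proof -
    obtain n where n: "a \<in> poly_values x n" using \<open>a \<in> Q\<close> by (auto simp: Q_def)
    have "x \<otimes> a = \<zero> \<oplus> x \<otimes> a" using that by simp
    then have "x \<otimes> a \<in> poly_values x (Suc n)" using n p_zero by auto
    then show ?thesis unfolding Q_def by blast
  qed
  have "subring T S"
    by (rule subringI) (use Q_add Q_uminus in \<open>auto simp: T_def l_distr l_minus m_assoc\<close>)
  moreover have "R \<subseteq> T" using Q_mult by (auto simp: T_def)
  ultimately have T: "T \<in> intermediate_rings R S" by (simp add: intermediate_rings_def)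
  have xT: "x \<in> T" using Q_x by (simp add: T_def)
  have "r \<otimes> t \<in> Q" if "r \<in> conductor R x" "t \<in> T" for r t
  proof -
    have "r \<in> p" using that c by blast
    then have "r \<in> poly_values x 0" by simp
    then have "r \<in> Q" unfolding Q_def by blast
    then have "t \<otimes> r \<in> Q" using that by (simp add: T_def)
    moreover have "t \<in> carrier S" using that by (simp add: T_def)
    ultimately show ?thesis using \<open>r \<in> p\<close> by (simp add: m_comm)
  qed
  with dense T xT Q_sub have "\<one> \<in> Q" unfolding conductors_dense_def by blast
  then show ?thesis by (auto simp: Q_def)
qed

text \<open>
  If \<open>x\<close> has no denominator outside \<open>p\<close>, then some \<open>f\<close> outside \<open>p\<close> is a polynomial value at \<open>x\<close>.  Writing
  \<open>f = c + x y\<close> with \<open>c \<in> p\<close> yields a candidate \<open>y\<close> for the inverse, up to the factor \<open>f - c\<close>.  If \<open>y\<close>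
  had no denominator outside \<open>p\<close> either, there would be polynomial values outside \<open>p\<close> at both \<open>x\<close>
  and \<open>y\<close>, and the larger of the two minimal degrees could be lowered.
\<close>

lemma fraction_or_inverse:
  assumes dense: conductors_dense and x: "x \<in> carrier S"
  shows "x \<in> localisation R \<or> (\<exists>y\<in>R. x \<otimes> y \<in> R - p)"
proof (rule ccontr)
  assume neg: "\<not> ?thesis"
  note [simp] = x
  \<comment> \<open>The least degree is positive: in degree 0 the only polynomial values are the elements of \<open>p\<close>.\<close>
  define deg where "deg z = (LEAST n. \<exists>f\<in>poly_values z n. f \<in> R - p)" for z
  have deg: "\<exists>n. deg z = Suc n \<and> (\<exists>f\<in>poly_values z (Suc n). f \<in> R - p) \<and> \<not> (\<exists>f\<in>poly_values z n. f \<in> R - p)"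
    if z: "z \<in> carrier S" "z \<notin> localisation R" for z
  proof -
    have "conductor R z \<subseteq> p"
      using z by (auto simp: conductor_def localisation_def)
    with dense z have "\<exists>n. \<one> \<in> poly_values z n" by (intro one_in_poly_values)
    then have ex: "\<exists>n. \<exists>f\<in>poly_values z n. f \<in> R - p" using p_one R_closed(3) by blast
    from LeastI_ex[OF ex] have 1: "\<exists>f\<in>poly_values z (deg z). f \<in> R - p" unfolding deg_def .
    then have "deg z \<noteq> 0" by (intro notI) auto
    then obtain n where n: "deg z = Suc n" using not0_implies_Suc by blast
    then have "\<not> (\<exists>f\<in>poly_values z n. f \<in> R - p)"
      using not_less_Least[of n "\<lambda>n. \<exists>f\<in>poly_values z n. f \<in> R - p"] by (simp add: deg_def)
    with 1 n show ?thesis by auto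
  qed
  obtain n f where n: "f \<in> poly_values x (Suc n)" "f \<in> R - p" "\<not> (\<exists>f\<in>poly_values x n. f \<in> R - p)"
    using deg[OF x] neg by blast
  obtain c y where y: "c \<in> p" "y \<in> poly_values x n" "f = c \<oplus> x \<otimes> y" using n by auto
  have [simp]: "y \<in> carrier S" "c \<in> carrier S" using y poly_values_carrier[OF x] by auto
  have "f \<ominus> c = x \<otimes> y" using y(3) add_diff_cancel_left by simp
  then have s: "x \<otimes> y \<in> R - p" using outside_diff[OF n(2) y(1)] by simp
  have "y \<notin> localisation R"
  proof
    assume "y \<in> localisation R"
    then obtain r where r: "r \<in> R - p" "r \<otimes> y \<in> R" by (rule localisationE)
    have "x \<otimes> (r \<otimes> y) = r \<otimes> (x \<otimes> y)" using r by (simp add: m_ac)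
    then have "x \<otimes> (r \<otimes> y) \<in> R - p" using outside_mult[OF r(1) s] by simp
    with neg r show False by blast
  qed
  then obtain k g where k: "g \<in> poly_values y (Suc k)" "g \<in> R - p" "\<not> (\<exists>f\<in>poly_values y k. f \<in> R - p)"
    using deg[of y] by auto
  have s': "y \<otimes> x \<in> R" "x \<otimes> y \<in> R" using s by (simp_all add: m_comm)
  show False
  proof (cases "k \<le> n")
    case True
    then show False using degree_reduction[OF x _ s'(2) n(1,2) k(1,2)] n(3) by simp
  next
    case False
    then show False using degree_reduction[OF _ x s'(1) k(1,2) n(1,2)] k(3) by simp
  qed
qed

text \<open>
  Suppose that \<open>u \<in> U\<close> and \<open>v \<in> V\<close> violate the two inclusions.  Then \<open>u\<close> is not in \<open>R\<close> locally, so
  it has an inverse \<open>a\<close> there, up to a factor outside \<open>p\<close>.  The quotient \<open>v a\<close> of \<open>v\<close> by \<open>u\<close> or its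
  inverse lies in \<open>R\<close> locally; in the first case \<open>v\<close> is a multiple of \<open>u\<close>, in the second \<open>u\<close> is
  one of \<open>v\<close>.
\<close>

lemma localised_chain:
  assumes dense: conductors_dense
    and U: "U \<in> intermediate_rings R S" and V: "V \<in> intermediate_rings R S"
  shows "U \<subseteq> localisation V \<or> V \<subseteq> localisation U"
proof (rule ccontr)
  assume "\<not> ?thesis"
  then obtain u v where u: "u \<in> U" "u \<notin> localisation V" and v: "v \<in> V" "v \<notin> localisation U" by blast
  note Us = subringE[OF intermediateD(1)[OF U]] and Vs = subringE[OF intermediateD(1)[OF V]]
  have RU: "R \<subseteq> U" and RV: "R \<subseteq> V" using U V intermediateD(2) by auto
  have [simp]: "u \<in> carrier S" "v \<in> carrier S" using u v Us(1) Vs(1) by auto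
  have "u \<notin> localisation R" using u(2) RV by (auto simp: localisation_def)
  then obtain a where a: "a \<in> R" "u \<otimes> a \<in> R - p" using fraction_or_inverse[OF dense, of u] by auto
  have [simp]: "a \<in> carrier S" using a by auto
  have "v \<otimes> a \<in> carrier S" by simp
  from fraction_or_inverse[OF dense this] show False
  proof (elim disjE bexE)
    assume "v \<otimes> a \<in> localisation R"
    then obtain r where r: "r \<in> R - p" "r \<otimes> (v \<otimes> a) \<in> R" by (rule localisationE)
    have "(r \<otimes> (u \<otimes> a)) \<otimes> v = (r \<otimes> (v \<otimes> a)) \<otimes> u" using r by (simp add: m_ac)
    moreover have "(r \<otimes> (v \<otimes> a)) \<otimes> u \<in> U" using Us(6) RU r u by blast
    ultimately have "v \<in> localisation U"
      using localisationI[of v "r \<otimes> (u \<otimes> a)" U] outside_mult[OF r(1) a(2)] by simp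
    with v show False by simp
  next
    fix y assume y: "y \<in> R" "v \<otimes> a \<otimes> y \<in> R - p"
    have "(v \<otimes> a \<otimes> y) \<otimes> u = ((u \<otimes> a) \<otimes> y) \<otimes> v" using y(1) by (simp add: m_ac)
    moreover have "((u \<otimes> a) \<otimes> y) \<otimes> v \<in> V"
      using Vs(6) RV R_closed(6) a(2) y(1) v(1) by blast
    ultimately have "u \<in> localisation V"
      using localisationI[of u "v \<otimes> a \<otimes> y" V] y by simp
    with u show False by simp
  qed
qed

end

section \<open>Distributivity of the lattice of intermediate rings\<close>

context ring_ext
begin

definition compositum :: "'a set \<Rightarrow> 'a set \<Rightarrow> 'a set"
  where "compositum U V = generate_ring S (U \<union> V)"

lemma compositum_intermediate:
  assumes "U \<in> intermediate_rings R S" "V \<in> intermediate_rings R S"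
  shows "compositum U V \<in> intermediate_rings R S"
proof -
  have "U \<union> V \<subseteq> carrier S" using assms intermediateD(3) by blast
  then have "subring (compositum U V) S" unfolding compositum_def by (rule generate_ring_is_subring)
  moreover have "R \<subseteq> compositum U V"
    using intermediateD(2)[OF assms(1)] by (auto simp: compositum_def intro: generate_ring.incl)
  ultimately show ?thesis by (simp add: intermediate_rings_def)
qed

lemma compositum_upper:
  shows "U \<subseteq> compositum U V" and "V \<subseteq> compositum U V"
  by (auto simp: compositum_def intro: generate_ring.incl)

lemma compositum_least:
  assumes "U \<subseteq> W" "V \<subseteq> W" "subring W S"
  shows "compositum U V \<subseteq> W"
  unfolding compositum_def
  using assms subringE(1)[OF assms(3)] by (intro generate_ring_min_subring1) auto

lemma inter_intermediate:
  assumes "U \<in> intermediate_rings R S" "V \<in> intermediate_rings R S"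
  shows "U \<inter> V \<in> intermediate_rings R S"
  using assms subring_inter by (auto simp: intermediate_rings_def)

lemma conductor_ideal:
  assumes W: "W \<in> intermediate_rings R S" and x: "x \<in> carrier S"
  shows "ideal (conductor W x) (as_ring S R)"
proof -
  note Ws = subringE[OF intermediateD(1)[OF W]] and RW = intermediateD(2)[OF W]
  have ring: "ring (as_ring S R)" unfolding as_ring_def using subring_R by (rule subring_is_ring)
  have sg: "subgroup R (add_monoid S)" using subring_R by (simp add: subring_def)
  have inv: "inv\<^bsub>add_monoid (as_ring S R)\<^esub> a = \<ominus> a" if "a \<in> R" for a
    using add.m_inv_consistent[OF sg that] by (simp add: as_ring_def a_inv_def)
  show ?thesis
  proof (rule idealI[OF ring])
    show "subgroup (conductor W x) (add_monoid (as_ring S R))"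
    proof (rule group.subgroupI)
      show "group (add_monoid (as_ring S R))"
        using ring abelian_group.a_group ring.is_abelian_group by blast
      show "conductor W x \<subseteq> carrier (add_monoid (as_ring S R))"
        by (auto simp: conductor_def as_ring_def)
      have "\<zero> \<in> conductor W x" using x R_closed(2) Ws(2) by (simp add: conductor_def)
      then show "conductor W x \<noteq> {}" by blast
      fix a assume a: "a \<in> conductor W x"
      then show "inv\<^bsub>add_monoid (as_ring S R)\<^esub> a \<in> conductor W x"
        using x R_closed(5) Ws(5) inv[of a] by (auto simp: conductor_def l_minus)
      fix b assume "b \<in> conductor W x"
      with a show "a \<otimes>\<^bsub>add_monoid (as_ring S R)\<^esub> b \<in> conductor W x"
        using x R_closed(7) Ws(7) by (auto simp: conductor_def as_ring_def l_distr)
    qed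
    fix a r assume "a \<in> conductor W x" "r \<in> carrier (as_ring S R)"
    then have "r \<otimes> a \<in> conductor W x" "a \<otimes> r \<in> conductor W x"
      using x R_closed(6) Ws(6) RW by (auto simp: conductor_def as_ring_def m_assoc m_comm[of a])
    then show "r \<otimes>\<^bsub>as_ring S R\<^esub> a \<in> conductor W x" "a \<otimes>\<^bsub>as_ring S R\<^esub> r \<in> conductor W x"
      by (simp_all add: as_ring_def)
  qed
qed

text \<open>
  For \<open>x\<close> on the left and \<open>W\<close> the ring on the right, membership of \<open>x\<close> in \<open>W\<close> means that the ideal
  \<open>{r \<in> R. r x \<in> W}\<close> is not proper.  Otherwise a prime \<open>p\<close> contains it.  At \<open>p\<close> one of \<open>U\<close>, \<open>V\<close>
  contains the other, hence also the compositum, and therefore a multiple \<open>r x\<close> with \<open>r\<close> outside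
  \<open>p\<close> lies in \<open>T \<inter> U\<close> or \<open>T \<inter> V\<close>, contradicting the choice of \<open>p\<close>.
\<close>

lemma inter_compositum_subset:
  assumes dense: conductors_dense
    and T: "T \<in> intermediate_rings R S"
    and U: "U \<in> intermediate_rings R S" and V: "V \<in> intermediate_rings R S"
  shows "T \<inter> compositum U V \<subseteq> compositum (T \<inter> U) (T \<inter> V)"
proof
  fix x assume x: "x \<in> T \<inter> compositum U V"
  define W where "W = compositum (T \<inter> U) (T \<inter> V)"
  have W: "W \<in> intermediate_rings R S"
    unfolding W_def by (intro compositum_intermediate inter_intermediate T U V)
  have xS [simp]: "x \<in> carrier S" using x intermediateD(3)[OF T] by blast
  have cr: "cring (as_ring S R)"
    unfolding as_ring_def using subcring_iff[OF R_closed(1)] subcringI'[OF subring_R] by blast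
  have "\<one> \<in> conductor W x"
  proof (rule ccontr)
    assume "\<one> \<notin> conductor W x"
    then obtain p where p: "primeideal p (as_ring S R)" "conductor W x \<subseteq> p"
      using cring.proper_ideal_in_prime_ideal[OF cr conductor_ideal[OF W xS]] by (auto simp: as_ring_def)
    interpret prime_of_ring_ext S R p
      by (intro prime_of_ring_ext.intro ring_ext_axioms prime_of_ring_ext_axioms.intro p(1))
    have key: False if A: "A = U \<or> A = V" and le: "U \<subseteq> localisation A" "V \<subseteq> localisation A" for A
    proof -
      have Ai: "A \<in> intermediate_rings R S" using A U V by auto
      have "x \<in> localisation A"
        using compositum_least[OF le subring_localisation[OF Ai]] x by blast
      then obtain r where r: "r \<in> R - p" "r \<otimes> x \<in> A" by (rule localisationE)
      have "r \<otimes> x \<in> T"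
        using subringE(6)[OF intermediateD(1)[OF T]] intermediateD(2)[OF T] r x by blast
      with r A have "r \<otimes> x \<in> (T \<inter> U) \<union> (T \<inter> V)" by blast
      then have "r \<otimes> x \<in> W"
        unfolding W_def using compositum_upper(1)[of "T \<inter> U" "T \<inter> V"]
          compositum_upper(2)[of "T \<inter> V" "T \<inter> U"] by blast
      with r p(2) show False by (auto simp: conductor_def)
    qed
    have "U \<subseteq> localisation U" "V \<subseteq> localisation V"
      using localisation_incl intermediateD(3) U V by auto
    then show False using localised_chain[OF dense U V] key by blast
  qed
  then show "x \<in> compositum (T \<inter> U) (T \<inter> V)" by (simp add: conductor_def W_def)
qed

lemma carrier_intermediate_order: "carrier (intermediate_order R S) = intermediate_rings R S"
  by (simp add: intermediate_order_def)

lemma intermediate_partial_order: "partial_order (intermediate_order R S)"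
  by unfold_locales (auto simp: intermediate_order_def)

lemma intermediate_sup:
  assumes "U \<in> intermediate_rings R S" "V \<in> intermediate_rings R S"
  shows "least (intermediate_order R S) (compositum U V) (Upper (intermediate_order R S) {U, V})"
proof (rule least_UpperI)
  show "Z \<in> {U, V} \<Longrightarrow> Z \<sqsubseteq>\<^bsub>intermediate_order R S\<^esub> compositum U V" for Z
    using compositum_upper(1)[of U V] compositum_upper(2)[of V U] by (auto simp: intermediate_order_def)
  show "Z \<in> Upper (intermediate_order R S) {U, V} \<Longrightarrow> compositum U V \<sqsubseteq>\<^bsub>intermediate_order R S\<^esub> Z" for Z
    using compositum_least[of U Z V] assms by (auto simp: intermediate_order_def Upper_def intermediate_rings_def)
qed (use assms compositum_intermediate in \<open>auto simp: intermediate_order_def\<close>)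

lemma intermediate_inf:
  assumes "U \<in> intermediate_rings R S" "V \<in> intermediate_rings R S"
  shows "greatest (intermediate_order R S) (U \<inter> V) (Lower (intermediate_order R S) {U, V})"
proof (rule greatest_LowerI)
  show "Z \<in> Lower (intermediate_order R S) {U, V} \<Longrightarrow> Z \<sqsubseteq>\<^bsub>intermediate_order R S\<^esub> U \<inter> V" for Z
    using assms by (auto simp: intermediate_order_def Lower_def)
qed (use assms inter_intermediate in \<open>auto simp: intermediate_order_def\<close>)

lemma intermediate_lattice: "lattice (intermediate_order R S)"
proof -
  interpret partial_order "intermediate_order R S" by (rule intermediate_partial_order)
  show ?thesis
    by unfold_locales (auto simp: intermediate_order_def dest: intermediate_sup[unfolded intermediate_order_def] intermediate_inf[unfolded intermediate_order_def])
qed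

lemma join_eq_compositum:
  assumes "U \<in> intermediate_rings R S" "V \<in> intermediate_rings R S"
  shows "U \<squnion>\<^bsub>intermediate_order R S\<^esub> V = compositum U V"
proof -
  interpret lattice "intermediate_order R S" by (rule intermediate_lattice)
  show ?thesis
    using least_unique[OF intermediate_sup[OF assms] ] sup_of_two_least[of U V] assms
    by (simp add: join_def intermediate_order_def)
qed

lemma meet_eq_inter:
  assumes "U \<in> intermediate_rings R S" "V \<in> intermediate_rings R S"
  shows "U \<sqinter>\<^bsub>intermediate_order R S\<^esub> V = U \<inter> V"
proof -
  interpret lattice "intermediate_order R S" by (rule intermediate_lattice)
  show ?thesis
    using greatest_unique[OF intermediate_inf[OF assms]] inf_of_two_greatest[of U V] assms
    by (simp add: meet_def intermediate_order_def)
qed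

lemma conductors_dense_imp_distributive:
  assumes dense: conductors_dense
  shows "distributive_extension R S"
proof -
  have "T \<inter> compositum U V = compositum (T \<inter> U) (T \<inter> V)"
    if "T \<in> intermediate_rings R S" "U \<in> intermediate_rings R S" "V \<in> intermediate_rings R S" for T U V
  proof
    show "T \<inter> compositum U V \<subseteq> compositum (T \<inter> U) (T \<inter> V)"
      using inter_compositum_subset[OF dense that] .
    show "compositum (T \<inter> U) (T \<inter> V) \<subseteq> T \<inter> compositum U V"
      using compositum_upper[of U V] compositum_upper[of V U] that
      by (intro compositum_least) (auto intro!: intermediateD(1) inter_intermediate compositum_intermediate)
  qed
  then have "distributive_lattice (intermediate_order R S)"
    unfolding distributive_lattice_def
    using intermediate_lattice
    by (simp add: carrier_intermediate_order join_eq_compositum meet_eq_inter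
        inter_intermediate compositum_intermediate)
  then show ?thesis
    using subring_R cring_axioms by (simp add: distributive_extension_def ring_extension_def)
qed

end

theorem theorem2p16:
  fixes S :: "('a, 'k) ring_scheme" and R :: "'a set"
  assumes "pruefer_extension R S"
  shows "distributive_extension R S"
proof -
  have S: "cring S" and R: "subring R S"
    using assms by (simp_all add: pruefer_extension_def ring_extension_def)
  interpret ring_ext S R
    by (intro ring_ext.intro ring_ext_axioms.intro S R)
  have conductors_dense
    unfolding conductors_dense_def
  proof (intro ballI allI impI)
    fix T x D
    assume T: "T \<in> intermediate_rings R S" and x: "x \<in> T" and D: "subgroup D (add_monoid S)"
      and prod: "\<forall>r\<in>conductor R x. \<forall>t\<in>T. r \<otimes>\<^bsub>S\<^esub> t \<in> D"
    have "flat_epimorphic S R T" using assms T by (simp add: pruefer_extension_def)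
    then show "\<one>\<^bsub>S\<^esub> \<in> D"
      using flat_epimorphism_conductor[OF R intermediateD(1,2)[OF T] _ x D] prod
      by (auto simp: conductor_def)
  qed
  then show ?thesis by (rule conductors_dense_imp_distributive)
qed

end
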